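(* Let $X$ be a Banach space with a shrinking unconditional Schauder basis whose unconditional constant $\mathcal{D}$ satisfies $\mathcal{D}<\sqrt{6}-1$. Then $X$ has the weak fixed point property.
   Context: A Schauder basis $(e_n)$ of $X$ is unconditional if for every $x\in X$ its expansion $x=\sum_n a_ne_n$ converges unconditionally; its unconditional constant is $$\sup\Big\{\Big\|\sum_{n=1}^\infty\epsilon_na_ne_n\Big\| : (\epsilon_n)\in\{-1,1\}^{\mathbb{N}},\ x=\sum_{n=1}^\infty a_ne_n\in X,\ \|x\|\le1\Big\}.$$ The basis is shrinking if for every $f\in X^*$ the norm of the restriction of $f$ to the closed linear span of $\{e_k:k\ge n\}$ tends to $0$ as $n\to\infty$. A mapping $T\colon C\to C$ on a subset $C$ of $X$ is nonexpansive if $\|Tx-Ty\|\le\|x-y\|$ for all $x,y\in C$. A Banach space $X$ has the weak fixed point property if for every nonempty weakly compact convex subset $C$ of $X$, every nonexpansive mapping $T\colon C\to C$ has a fixed point. *)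

theory Defs
  imports "HOL-Analysis.Analysis"
begin

text \<open>
  Spaces are real, as is usual in metric fixed point theory. Basis sequences are indexed from \<open>0\<close>.
\<close>

definition schauder_basis :: "(nat \<Rightarrow> 'a::real_normed_vector) \<Rightarrow> bool" where
  "schauder_basis e \<longleftrightarrow> (\<forall>x. \<exists>!a::nat \<Rightarrow> real. (\<lambda>n. a n *\<^sub>R e n) sums x)"

text \<open>A series converges unconditionally if each of its rearrangements converges.\<close>

definition unconditionally_convergent :: "(nat \<Rightarrow> 'a::real_normed_vector) \<Rightarrow> bool" where
  "unconditionally_convergent u \<longleftrightarrow> (\<forall>\<pi>::nat \<Rightarrow> nat. bij \<pi> \<longrightarrow> summable (\<lambda>n. u (\<pi> n)))"

definition unconditional_basis :: "(nat \<Rightarrow> 'a::real_normed_vector) \<Rightarrow> bool" where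
  "unconditional_basis e \<longleftrightarrow> schauder_basis e \<and>
     (\<forall>x a. (\<lambda>n. a n *\<^sub>R e n) sums x \<longrightarrow> unconditionally_convergent (\<lambda>n. a n *\<^sub>R e n))"

text \<open>
  The supremum is taken in \<open>ereal\<close>, so no boundedness is presupposed. For an unconditional basis
  of a Banach space all the sign-changed series converge, so \<open>suminf\<close> is their actual sum.
\<close>

definition unconditional_constant :: "(nat \<Rightarrow> 'a::real_normed_vector) \<Rightarrow> ereal" where
  "unconditional_constant e =
     Sup {ereal (norm (\<Sum>n. (\<epsilon> n * a n) *\<^sub>R e n)) | \<epsilon> a x.
            (\<forall>n. \<epsilon> n \<in> {-1, 1::real}) \<and> (\<lambda>n. a n *\<^sub>R e n) sums x \<and> norm x \<le> 1}"

definition norm_restricted ::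
    "'a set \<Rightarrow> ('a::real_normed_vector \<Rightarrow>\<^sub>L real) \<Rightarrow> real" where
  "norm_restricted S f = (SUP x\<in>{x\<in>S. norm x \<le> 1}. \<bar>blinfun_apply f x\<bar>)"

definition shrinking_basis :: "(nat \<Rightarrow> 'a::real_normed_vector) \<Rightarrow> bool" where
  "shrinking_basis e \<longleftrightarrow> schauder_basis e \<and>
     (\<forall>f::'a \<Rightarrow>\<^sub>L real. (\<lambda>n. norm_restricted (closure (span (e ` {n..}))) f) \<longlonglongrightarrow> 0)"

text \<open>
  The initial topology of the evaluation map from the space into the functions on its dual,
  which carry the topology of pointwise convergence.
\<close>

definition weak_topology :: "'a::real_normed_vector topology" where
  "weak_topology =
     pullback_topology UNIV (\<lambda>x (f::'a \<Rightarrow>\<^sub>L real). blinfun_apply f x) euclidean"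

definition nonexpansive_on :: "'a::real_normed_vector set \<Rightarrow> ('a \<Rightarrow> 'a) \<Rightarrow> bool" where
  "nonexpansive_on C T \<longleftrightarrow> (\<forall>x\<in>C. \<forall>y\<in>C. norm (T x - T y) \<le> norm (x - y))"

definition weak_fixed_point_property :: "'a::real_normed_vector itself \<Rightarrow> bool" where
  "weak_fixed_point_property (_ :: 'a itself) \<longleftrightarrow>
     (\<forall>(C::'a set) T. C \<noteq> {} \<and> compactin weak_topology C \<and> convex C \<and>
        T \<in> C \<rightarrow> C \<and> nonexpansive_on C T \<longrightarrow> (\<exists>x\<in>C. T x = x))"

end

theory Submission
  imports Defs
begin

text \<open>
  Suppose that a nonexpansive map \<open>T\<close> has no fixed point on a weakly compact convex set. Zorn's lemma
  gives a minimal nonempty closed convex invariant subset \<open>K\<close>, of diameter \<open>d > 0\<close>. In such a set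
  approximate fixed points are far from every point: if \<open>\<parallel>T z - z\<parallel>\<close> is small then \<open>\<parallel>z - u\<parallel>\<close> is
  almost \<open>d\<close> for each given \<open>u \<in> K\<close> (\<open>goebel_karlovitz\<close>). The contradiction comes from an approximate
  fixed point that is too close to a point \<open>p \<in> K\<close>, as in Lin's argument for unconditional bases.

  Let \<open>(x\<^sub>n)\<close> be approximate fixed points in \<open>K\<close> that converge weakly to \<open>p\<close>. Up to small errors
  \<open>x\<^sub>n - p\<close> and \<open>x\<^sub>m - p\<close> have disjoint finite supports when \<open>m\<close> is much larger than \<open>n\<close>. Hence
  a change of signs turns \<open>x\<^sub>n - x\<^sub>m\<close>, of norm at most \<open>d\<close>, into \<open>(x\<^sub>n - p) + (x\<^sub>m - p)\<close>, so the
  midpoint of \<open>x\<^sub>n\<close> and \<open>x\<^sub>m\<close> has distance at most about \<open>D d / 2\<close> from \<open>p\<close>, and \<open>d / 2\<close> from each of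
  \<open>x\<^sub>n\<close> and \<open>x\<^sub>m\<close>. Consider all double sequences \<open>w\<close> in \<open>K\<close> that satisfy these three bounds in the
  iterated limit, with some point \<open>u \<in> K\<close> in place of \<open>p\<close>. They form a convex \<open>T\<close>-invariant family,
  so it contains some \<open>w\<close> whose entries are all approximate fixed points.

  Let \<open>A\<close> be a finite block of coordinates that carries almost all of \<open>x\<^sub>n - p\<close> and almost nothing
  of \<open>u - p\<close>, let \<open>N\<close> be much larger than \<open>A\<close>, and let \<open>P\<close> denote coordinate projections. Then
  \<open>2 v = P\<^bsub>[0,N)\<^esub> v + (v - P\<^bsub>A\<^esub> v) + (v - P\<^bsub>[0,N) - A\<^esub> v)\<close> for \<open>v = w n m - p\<close>.

  \<^item> \<open>I - P\<^bsub>A\<^esub>\<close> almost kills \<open>x\<^sub>n - p\<close>, so the second term is the image of \<open>w n m - x\<^sub>n\<close> and has norm at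
    most about \<open>(1 + D) / 2 * d / 2\<close>.
  \<^item> \<open>I - P\<^bsub>[0,N) - A\<^esub>\<close> almost kills \<open>u - p\<close>, so the third term is at most about
    \<open>(1 + D) / 2 * D d / 2\<close>.
  \<^item> For the first term no factor \<open>(1 + D) / 2\<close> is lost. If \<open>q\<close> is a weak cluster point of \<open>w n m\<close> as
    \<open>m\<close> grows, then for suitable \<open>m\<close> the first term is almost \<open>q - p\<close>. This is a weak cluster point
    of \<open>w n m - x\<^sub>m\<close>, because \<open>x\<^sub>m - p\<close> is weakly null, so its norm is at most \<open>d / 2\<close>.

  Since \<open>\<parallel>v\<parallel>\<close> is almost \<open>d\<close>, this gives \<open>2 \<le> 1 / 2 + (1 + D) / 4 + D (1 + D) / 4\<close>, that is
  \<open>D\<^sup>2 + 2 D \<ge> 5\<close>, whereas \<open>D < sqrt 6 - 1\<close> means \<open>(D + 1)\<^sup>2 < 6\<close>.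

  Two facts about weak topologies are needed: closed convex sets are weakly closed, which
  follows from a Hahn-Banach theorem obtained from minimal sublinear functionals, and weakly
  compact sets are bounded, by Baire's theorem on the dual.
\<close>

section \<open>Sublinear functionals and separation\<close>

definition sublinear :: "('a::real_vector \<Rightarrow> real) \<Rightarrow> bool" where
  "sublinear q \<longleftrightarrow> (\<forall>x y. q (x + y) \<le> q x + q y) \<and> (\<forall>t\<ge>0. \<forall>x. q (t *\<^sub>R x) = t * q x)"

lemma sublinearI:
  assumes add: "\<And>x y. q (x + y) \<le> q x + q y"
    and scale: "\<And>t x. t > 0 \<Longrightarrow> q (t *\<^sub>R x) \<le> t * q x" and zero: "q 0 = 0"
  shows "sublinear q"
  unfolding sublinear_def
proof (intro conjI allI impI)
  show "q (x + y) \<le> q x + q y" for x y by (rule add)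
  fix t :: real and x assume "t \<ge> 0"
  show "q (t *\<^sub>R x) = t * q x"
  proof (cases "t = 0")
    case False
    with \<open>t \<ge> 0\<close> have t: "t > 0" by simp
    have "q (inverse t *\<^sub>R (t *\<^sub>R x)) \<le> inverse t * q (t *\<^sub>R x)"
      using t by (intro scale) simp
    then have "t * q x \<le> q (t *\<^sub>R x)" using t by (simp add: field_simps)
    with scale[OF t, of x] show ?thesis by simp
  qed (simp add: zero)
qed

lemma sublinear_zero: "sublinear q \<Longrightarrow> q 0 = 0"
  unfolding sublinear_def by (metis mult_zero_left order_refl scale_zero_left)

lemma sublinear_minus: "sublinear q \<Longrightarrow> - q (- x) \<le> q x"
  using sublinear_zero[of q] unfolding sublinear_def by (smt (verit) add.right_inverse)

lemma sublinear_norm: "sublinear (norm :: 'a::real_normed_vector \<Rightarrow> real)"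
  by (auto simp: sublinear_def norm_triangle_ineq)

text \<open>
  The functional \<open>q'\<close> is the infimal convolution of \<open>q\<close> with the function that takes the value \<open>- t d\<close>
  at \<open>- t c\<close>. Convexity of \<open>C\<close> makes it subadditive, and the bound of \<open>q\<close> on \<open>C\<close> keeps the infimum
  finite. Below \<open>q'\<close> every linear functional is at least \<open>d\<close> on \<open>C\<close>.
\<close>

lemma sublinear_minorant_above:
  fixes q :: "'a::real_vector \<Rightarrow> real"
  assumes q: "sublinear q" and C: "convex C" "C \<noteq> {}" and d: "\<And>c. c \<in> C \<Longrightarrow> d \<le> q c"
  shows "\<exists>q'. sublinear q' \<and> q' \<le> q \<and> (\<forall>c\<in>C. q' (- c) \<le> - d)"
proof -
  have qadd: "q (x + y) \<le> q x + q y" for x y using q by (simp add: sublinear_def)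
  have qsc: "q (t *\<^sub>R x) = t * q x" if "t \<ge> 0" for t x using q that by (simp add: sublinear_def)
  define V where "V x = (\<lambda>(t, c). q (x + t *\<^sub>R c) - t * d) ` ({0..} \<times> C)" for x
  define q' where "q' x = Inf (V x)" for x
  have VI: "q (x + t *\<^sub>R c) - t * d \<in> V x" if "t \<ge> 0" "c \<in> C" for x t c
    unfolding V_def using that by (intro image_eqI[where x = "(t, c)"]) auto
  have VE: "\<exists>t c. t \<ge> 0 \<and> c \<in> C \<and> v = q (x + t *\<^sub>R c) - t * d" if "v \<in> V x" for v x
    using that unfolding V_def by auto
  have ne: "V x \<noteq> {}" for x using C VI[of 0] by fastforce
  have bd: "- q (- x) \<le> v" if v: "v \<in> V x" for x v
  proof -
    obtain t c where tc: "t \<ge> 0" "c \<in> C" "v = q (x + t *\<^sub>R c) - t * d" using VE[OF v] by blast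
    have "t * d \<le> t * q c" using tc d by (intro mult_left_mono) auto
    also have "\<dots> = q ((x + t *\<^sub>R c) + - x)" using qsc[OF tc(1), of c] by simp
    also have "\<dots> \<le> q (x + t *\<^sub>R c) + q (- x)" by (rule qadd)
    finally show ?thesis using tc by simp
  qed
  have bdd: "bdd_below (V x)" for x using bd by (meson bdd_belowI)
  have le: "q' x \<le> v" if "v \<in> V x" for x v
    unfolding q'_def using that bdd by (rule cInf_lower)
  have ge: "b \<le> q' x" if "\<And>v. v \<in> V x \<Longrightarrow> b \<le> v" for x b
    unfolding q'_def using ne that by (intro cInf_greatest) auto
  obtain c0 where c0: "c0 \<in> C" using C by blast
  have le_q: "q' x \<le> q x" for x using le[OF VI[OF order_refl c0, of x]] by simp
  have "sublinear q'"
  proof (rule sublinearI)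
    fix x y
    have "q' (x + y) \<le> v + w" if vw: "v \<in> V x" "w \<in> V y" for v w
    proof -
      obtain t c where tc: "t \<ge> 0" "c \<in> C" "v = q (x + t *\<^sub>R c) - t * d" using VE[OF vw(1)] by blast
      obtain s b where sb: "s \<ge> 0" "b \<in> C" "w = q (y + s *\<^sub>R b) - s * d" using VE[OF vw(2)] by blast
      \<comment> \<open>convexity merges the two cone elements into a single one\<close>
      have "\<exists>a\<in>C. (t + s) *\<^sub>R a = t *\<^sub>R c + s *\<^sub>R b"
      proof (cases "t + s = 0")
        case True
        then have "t = 0" "s = 0" using tc sb by auto
        then show ?thesis using c0 by auto
      next
        case False
        then have "(t / (t + s)) *\<^sub>R c + (s / (t + s)) *\<^sub>R b \<in> C"
          using tc sb by (intro convexD[OF C(1)]) (auto simp: add_divide_distrib[symmetric])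
        then show ?thesis using False
          by (intro bexI[where x = "(t / (t + s)) *\<^sub>R c + (s / (t + s)) *\<^sub>R b"]) (auto simp: scaleR_right_distrib)
      qed
      then obtain a where a: "a \<in> C" "(t + s) *\<^sub>R a = t *\<^sub>R c + s *\<^sub>R b" by blast
      have "q' (x + y) \<le> q ((x + y) + (t + s) *\<^sub>R a) - (t + s) * d"
        using tc sb a by (intro le VI) auto
      also have "(x + y) + (t + s) *\<^sub>R a = (x + t *\<^sub>R c) + (y + s *\<^sub>R b)" using a by simp
      also have "q \<dots> \<le> q (x + t *\<^sub>R c) + q (y + s *\<^sub>R b)" by (rule qadd)
      finally show ?thesis using tc sb by (simp add: algebra_simps)
    qed
    then have "q' (x + y) - w \<le> q' x" if "w \<in> V y" for w
      using that by (intro ge) (simp add: algebra_simps)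
    then have "q' (x + y) - q' x \<le> q' y"
      by (intro ge) (simp add: algebra_simps)
    then show "q' (x + y) \<le> q' x + q' y" by simp
  next
    fix r :: real and x assume r: "r > 0"
    have "q' (r *\<^sub>R x) / r \<le> q' x"
    proof (rule ge)
      fix v assume "v \<in> V x"
      then obtain t c where tc: "t \<ge> 0" "c \<in> C" "v = q (x + t *\<^sub>R c) - t * d" using VE by blast
      have "q' (r *\<^sub>R x) \<le> q (r *\<^sub>R x + (r * t) *\<^sub>R c) - (r * t) * d"
        using tc r by (intro le VI) auto
      also have "r *\<^sub>R x + (r * t) *\<^sub>R c = r *\<^sub>R (x + t *\<^sub>R c)" by (simp add: scaleR_right_distrib)
      also have "q \<dots> = r * q (x + t *\<^sub>R c)" using r by (simp add: qsc)
      finally have "q' (r *\<^sub>R x) \<le> r * v" by (simp add: tc(3) right_diff_distrib mult.assoc)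
      then show "q' (r *\<^sub>R x) / r \<le> v" using r by (simp add: field_simps)
    qed
    then show "q' (r *\<^sub>R x) \<le> r * q' x" using r by (simp add: field_simps)
  next
    have "0 \<le> q' 0" using bd[of _ 0] sublinear_zero[OF q] by (intro ge) auto
    then show "q' 0 = 0" using le_q[of 0] sublinear_zero[OF q] by simp
  qed
  moreover have "q' \<le> q" using le_q by (simp add: le_fun_def)
  moreover have "q' (- c) \<le> - d" if "c \<in> C" for c
    using le[OF VI[OF zero_le_one that, of "- c"]] sublinear_zero[OF q] by simp
  ultimately show ?thesis by blast
qed

text \<open>
  Lowering \<open>q\<close> with respect to a single point \<open>y\<close> and \<open>d = q y\<close> cannot change a minimal \<open>q\<close>. Hence
  \<open>q (- y) = - q y\<close>, and for an odd functional subadditivity becomes additivity.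
\<close>

lemma linear_minimal_sublinear:
  fixes q :: "'a::real_vector \<Rightarrow> real"
  assumes q: "sublinear q" and min: "\<And>r. sublinear r \<Longrightarrow> r \<le> q \<Longrightarrow> r = q"
  shows "linear q"
proof -
  have neg: "q (- y) = - q y" for y
  proof -
    obtain r where r: "sublinear r" "r \<le> q" "\<forall>c\<in>{y}. r (- c) \<le> - q y"
      using sublinear_minorant_above[OF q, of "{y}" "q y"] by auto
    then have "q (- y) \<le> - q y" using min by auto
    moreover have "- q (- y) \<le> q y" by (rule sublinear_minus[OF q])
    ultimately show ?thesis by simp
  qed
  have add_le: "q (x + y) \<le> q x + q y" for x y using q by (simp add: sublinear_def)
  show ?thesis
  proof (rule linearI)
    fix x y
    have "q (- x + - y) \<le> q (- x) + q (- y)" by (rule add_le)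
    then show "q (x + y) = q x + q y"
      using add_le[of x y] neg[of x] neg[of y] neg[of "x + y"] by simp
  next
    fix t x
    have sc: "q (s *\<^sub>R x) = s * q x" if "s \<ge> 0" for s using q that by (simp add: sublinear_def)
    show "q (t *\<^sub>R x) = t *\<^sub>R q x"
      using sc[of t] sc[of "- t"] neg[of "t *\<^sub>R x"] by (cases "t \<ge> 0") auto
  qed
qed

text \<open>
  Hahn-Banach by Zorn's lemma: all sublinear functionals below \<open>p\<close> are bounded below by
  \<open>- p (- x)\<close>, so pointwise infima of chains exist.
\<close>

lemma linear_below_sublinear:
  fixes p :: "'a::real_vector \<Rightarrow> real"
  assumes p: "sublinear p"
  shows "\<exists>f. linear f \<and> f \<le> p"
proof -
  define S where "S = {q. sublinear q \<and> q \<le> p}"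
  have "\<exists>m\<in>S. \<forall>a\<in>S. m \<ge> a \<longrightarrow> a = m"
  proof (rule predicate_Zorn)
    show "partial_order_on S (relation_of (\<lambda>x y. y \<le> x) S)"
      by (rule partial_order_on_relation_ofI) auto
  next
    fix \<C> assume ch: "\<C> \<in> Chains (relation_of (\<lambda>x y. y \<le> x) S)"
    have sub: "\<C> \<subseteq> S" and tot: "\<And>q r. q \<in> \<C> \<Longrightarrow> r \<in> \<C> \<Longrightarrow> q \<le> r \<or> r \<le> q"
      using ch unfolding Chains_def relation_of_def by auto
    show "\<exists>u\<in>S. \<forall>a\<in>\<C>. u \<le> a"
    proof (cases "\<C> = {}")
      case True
      then show ?thesis using p by (auto simp: S_def)
    next
      case False
      define u where "u x = (INF q\<in>\<C>. q x)" for x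
      have low: "- p (- x) \<le> q x" if "q \<in> \<C>" for q x
      proof -
        have "q (- x) \<le> p (- x)" "sublinear q" using sub that by (auto simp: S_def le_fun_def)
        with sublinear_minus[of q x] show ?thesis by simp
      qed
      have bdd: "bdd_below ((\<lambda>q. q x) ` \<C>)" for x using low by (meson bdd_belowI2)
      have le: "u x \<le> q x" if "q \<in> \<C>" for q x
        unfolding u_def using bdd that by (rule cINF_lower)
      have ge: "b \<le> u x" if "\<And>q. q \<in> \<C> \<Longrightarrow> b \<le> q x" for b x
        unfolding u_def using False that by (rule cINF_greatest)
      have "sublinear u"
      proof (rule sublinearI)
        fix x y
        have "u (x + y) \<le> q x + r y" if qr: "q \<in> \<C>" "r \<in> \<C>" for q r
        proof -
          obtain m where m: "m \<in> \<C>" "m \<le> q" "m \<le> r" using tot[OF qr] qr by blast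
          have "u (x + y) \<le> m (x + y)" by (rule le[OF m(1)])
          also have "\<dots> \<le> m x + m y" using m sub by (auto simp: S_def sublinear_def)
          also have "\<dots> \<le> q x + r y" using m by (intro add_mono) (auto simp: le_fun_def)
          finally show ?thesis .
        qed
        then have "u (x + y) - r y \<le> u x" if "r \<in> \<C>" for r
          using that by (intro ge) (simp add: algebra_simps)
        then have "u (x + y) - u x \<le> u y" by (intro ge) (simp add: algebra_simps)
        then show "u (x + y) \<le> u x + u y" by simp
      next
        fix t :: real and x assume t: "t > 0"
        have "u (t *\<^sub>R x) / t \<le> u x"
        proof (rule ge)
          fix q assume q: "q \<in> \<C>"
          then have "q (t *\<^sub>R x) = t * q x" using sub t by (auto simp: S_def sublinear_def)
          with le[OF q, of "t *\<^sub>R x"] t show "u (t *\<^sub>R x) / t \<le> q x" by (simp add: field_simps)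
        qed
        then show "u (t *\<^sub>R x) \<le> t * u x" using t by (simp add: field_simps)
      next
        have "q 0 = 0" if "q \<in> \<C>" for q using sub that sublinear_zero by (auto simp: S_def)
        then have "(\<lambda>q. q 0) ` \<C> = (\<lambda>q. 0) ` \<C>" by (intro image_cong) auto
        then have "(\<lambda>q. q 0) ` \<C> = {0}" using False by (simp add: image_constant_conv)
        then show "u 0 = 0" unfolding u_def by simp
      qed
      moreover have "u \<le> p"
      proof -
        obtain q where "q \<in> \<C>" "q \<le> p" using False sub by (auto simp: S_def)
        then show ?thesis using le[of q] by (auto simp: le_fun_def intro: order_trans)
      qed
      ultimately show ?thesis using le by (intro bexI[of _ u]) (auto simp: S_def le_fun_def)
    qed
  qed
  then obtain m where m: "m \<in> S" "\<And>a. a \<in> S \<Longrightarrow> a \<le> m \<Longrightarrow> a = m" by blast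
  have "linear m"
    using m by (intro linear_minimal_sublinear) (auto simp: S_def intro: order_trans)
  then show ?thesis using m by (auto simp: S_def)
qed

text \<open>
  The sandwich theorem of Mazur and Orlicz; with \<open>q = norm\<close> it yields both norming functionals and
  the separation of points from closed convex sets.
\<close>

theorem sandwich_functional:
  fixes q :: "'a::real_vector \<Rightarrow> real"
  assumes "sublinear q" "convex C" "C \<noteq> {}" "\<And>c. c \<in> C \<Longrightarrow> d \<le> q c"
  shows "\<exists>f. linear f \<and> f \<le> q \<and> (\<forall>c\<in>C. d \<le> f c)"
proof -
  obtain r where r: "sublinear r" "r \<le> q" "\<forall>c\<in>C. r (- c) \<le> - d"
    using sublinear_minorant_above[OF assms] by blast
  obtain f where f: "linear f" "f \<le> r" using linear_below_sublinear[OF r(1)] by blast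
  have "d \<le> f c" if "c \<in> C" for c
  proof -
    have "f (- c) \<le> - d" using f(2) r(3) that by (auto simp: le_fun_def intro: order_trans)
    then show ?thesis using linear_neg[OF f(1)] by simp
  qed
  with f r show ?thesis by (blast intro: order_trans)
qed

corollary functional_above_distance:
  fixes C :: "'a::real_normed_vector set"
  assumes "convex C" "C \<noteq> {}" "\<And>c. c \<in> C \<Longrightarrow> d \<le> norm c"
  shows "\<exists>f::'a \<Rightarrow>\<^sub>L real. (\<forall>x. \<bar>f x\<bar> \<le> norm x) \<and> (\<forall>c\<in>C. d \<le> f c)"
proof -
  obtain f where f: "linear f" "f \<le> norm" "\<forall>c\<in>C. d \<le> f c"
    using sandwich_functional[OF sublinear_norm assms] by blast
  have b: "\<bar>f x\<bar> \<le> norm x" for x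
    using f(2) linear_neg[OF f(1), of x] unfolding le_fun_def by (metis abs_le_iff norm_minus_cancel)
  have "bounded_linear f"
    using f(1) b by (intro bounded_linear_intro[where K = 1]) (auto simp: linear_add linear_scale)
  then show ?thesis using f b by (intro exI[of _ "Blinfun f"]) (simp add: bounded_linear_Blinfun_apply)
qed

corollary norming_functional:
  fixes x :: "'a::real_normed_vector"
  shows "\<exists>f::'a \<Rightarrow>\<^sub>L real. (\<forall>y. \<bar>f y\<bar> \<le> norm y) \<and> f x = norm x"
proof -
  obtain f :: "'a \<Rightarrow>\<^sub>L real" where f: "\<forall>y. \<bar>f y\<bar> \<le> norm y" "norm x \<le> f x"
    using functional_above_distance[of "{x}" "norm x"] by auto
  moreover have "f x \<le> norm x" using f(1) abs_le_D1 by blast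
  ultimately have "f x = norm x" by simp
  with f show ?thesis by blast
qed

corollary separating_functional:
  fixes S :: "'a::real_normed_vector set"
  assumes "closed S" "convex S" "x \<notin> S"
  shows "\<exists>(f::'a \<Rightarrow>\<^sub>L real) d. d > 0 \<and> (\<forall>c\<in>S. f x + d \<le> f c)"
proof (cases "S = {}")
  case True
  then show ?thesis by (intro exI[of _ 0] exI[of _ 1]) auto
next
  case False
  have "open (- S)" "x \<in> - S" using assms by auto
  then obtain d where d: "d > 0" "ball x d \<subseteq> - S" using open_contains_ball by metis
  have "d \<le> norm c" if "c \<in> (\<lambda>s. s - x) ` S" for c
    using that d by (force simp: ball_def dist_norm norm_minus_commute)
  moreover have "convex ((\<lambda>s. s - x) ` S)" using assms(2) by simp
  ultimately obtain f :: "'a \<Rightarrow>\<^sub>L real" where "\<forall>c\<in>(\<lambda>s. s - x) ` S. d \<le> f c"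
    using functional_above_distance False by (metis image_is_empty)
  then show ?thesis using d by (intro exI[of _ f] exI[of _ d]) (auto simp: blinfun.diff_right algebra_simps)
qed

section \<open>Weakly compact sets\<close>

text \<open>
  Only finitely many functionals are tested at a time, which is exactly a basic neighbourhood in
  the weak topology.
\<close>

definition weak_cluster_point :: "'a::real_normed_vector filter \<Rightarrow> 'a \<Rightarrow> bool" where
  "weak_cluster_point F p \<longleftrightarrow>
     (\<forall>(G::('a \<Rightarrow>\<^sub>L real) set) \<epsilon>. finite G \<longrightarrow> \<epsilon> > 0 \<longrightarrow> (\<exists>\<^sub>F x in F. \<forall>f\<in>G. \<bar>blinfun_apply f x - blinfun_apply f p\<bar> < \<epsilon>))"

lemma compact_evaluations:
  fixes C :: "'a::real_normed_vector set"
  assumes "compactin weak_topology C"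
  shows "compact ((\<lambda>x (f::'a \<Rightarrow>\<^sub>L real). f x) ` C)"
proof -
  have "continuous_map weak_topology euclidean (\<lambda>x (f::'a \<Rightarrow>\<^sub>L real). f x)"
    using continuous_map_pullback[OF continuous_map_id, of UNIV "\<lambda>x (f::'a \<Rightarrow>\<^sub>L real). f x" euclidean]
    unfolding weak_topology_def by simp
  from image_compactin[OF assms this] show ?thesis by simp
qed

lemma weak_cluster_point_exists:
  fixes C :: "'a::real_normed_vector set"
  assumes C: "compactin weak_topology C" and F: "F \<noteq> bot" "\<forall>\<^sub>F x in F. x \<in> C"
  shows "\<exists>p\<in>C. weak_cluster_point F p"
proof -
  let ?\<Phi> = "\<lambda>x (f::'a \<Rightarrow>\<^sub>L real). blinfun_apply f x"
  have "filtermap ?\<Phi> F \<noteq> bot" "eventually (\<lambda>g. g \<in> ?\<Phi> ` C) (filtermap ?\<Phi> F)"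
    using F by (auto simp: filtermap_bot_iff eventually_filtermap elim: eventually_mono)
  with compact_evaluations[OF C] obtain p where p: "p \<in> C" "inf (nhds (?\<Phi> p)) (filtermap ?\<Phi> F) \<noteq> bot"
    unfolding compact_filter by blast
  have "weak_cluster_point F p"
    unfolding weak_cluster_point_def
  proof (intro allI impI)
    fix G :: "('a \<Rightarrow>\<^sub>L real) set" and \<epsilon> :: real assume G: "finite G" "\<epsilon> > 0"
    have "open ({g::('a \<Rightarrow>\<^sub>L real) \<Rightarrow> real. g f \<in> ball (blinfun_apply f p) \<epsilon>})" for f :: "'a \<Rightarrow>\<^sub>L real"
      using open_vimage[OF open_ball continuous_on_product_coordinates[of f], of "f p" \<epsilon>]
      by (simp add: vimage_def)
    then have "open (\<Inter>f\<in>G. {g::('a \<Rightarrow>\<^sub>L real) \<Rightarrow> real. g f \<in> ball (blinfun_apply f p) \<epsilon>})"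
      using G by (intro open_INT) auto
    moreover have "?\<Phi> p \<in> (\<Inter>f\<in>G. {g::('a \<Rightarrow>\<^sub>L real) \<Rightarrow> real. g f \<in> ball (blinfun_apply f p) \<epsilon>})" using G by auto
    ultimately have nh: "\<forall>\<^sub>F g in nhds (?\<Phi> p). g \<in> (\<Inter>f\<in>G. {g::('a \<Rightarrow>\<^sub>L real) \<Rightarrow> real. g f \<in> ball (blinfun_apply f p) \<epsilon>})"
      by (rule eventually_nhds_in_open)
    show "\<exists>\<^sub>F x in F. \<forall>f\<in>G. \<bar>blinfun_apply f x - blinfun_apply f p\<bar> < \<epsilon>"
    proof (rule ccontr)
      assume "\<not> ?thesis"
      then have "\<forall>\<^sub>F x in F. \<not> (\<forall>f\<in>G. \<bar>blinfun_apply f x - blinfun_apply f p\<bar> < \<epsilon>)" by (simp add: not_frequently)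
      then have "\<forall>\<^sub>F g in filtermap ?\<Phi> F. g \<notin> (\<Inter>f\<in>G. {g::('a \<Rightarrow>\<^sub>L real) \<Rightarrow> real. g f \<in> ball (blinfun_apply f p) \<epsilon>})"
        by (simp add: eventually_filtermap dist_real_def abs_minus_commute)
      with nh have "\<forall>\<^sub>F g in inf (nhds (?\<Phi> p)) (filtermap ?\<Phi> F). False"
        unfolding eventually_inf by blast
      with p(2) show False by (simp add: trivial_limit_def)
    qed
  qed
  with p(1) show ?thesis by blast
qed

text \<open>
  Mazur's theorem in the form needed here: a functional that separates \<open>p\<close> from \<open>S\<close> also keeps the
  filter away from \<open>p\<close>.
\<close>

lemma weak_cluster_point_closed_convex:
  assumes p: "weak_cluster_point F p" and S: "closed S" "convex S" and ev: "\<forall>\<^sub>F x in F. x \<in> S"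
  shows "p \<in> S"
proof (rule ccontr)
  assume "p \<notin> S"
  then obtain f :: "'a \<Rightarrow>\<^sub>L real" and d where f: "d > 0" "\<forall>c\<in>S. f p + d \<le> f c"
    using separating_functional[OF S] by blast
  have "\<exists>\<^sub>F x in F. \<forall>g\<in>{f}. \<bar>blinfun_apply g x - blinfun_apply g p\<bar> < d"
    using p f(1) unfolding weak_cluster_point_def by blast
  then have "\<exists>\<^sub>F x in F. \<bar>f x - f p\<bar> < d \<and> x \<in> S"
    using ev by (intro frequently_eventually_frequently) simp_all
  then obtain x where "\<bar>f x - f p\<bar> < d" "x \<in> S" using frequently_ex by fast
  moreover then have "f p + d \<le> f x" using f(2) by blast
  ultimately show False by linarith
qed

text \<open>
  In a weakly compact set a sequence converges weakly as soon as it has only one weak cluster point,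
  and a separating family of functionals determines the cluster points.
\<close>

lemma weakly_convergent_if_separated:
  fixes C :: "'a::real_normed_vector set" and h :: "nat \<Rightarrow> 'a \<Rightarrow>\<^sub>L real"
  assumes C: "compactin weak_topology C" and x: "\<And>n::nat. x n \<in> C"
    and conv: "\<And>k. (\<lambda>n. h k (x n)) \<longlonglongrightarrow> h k p"
    and sep: "\<And>q. (\<And>k. h k q = h k p) \<Longrightarrow> q = p"
  shows "(\<lambda>n. blinfun_apply (f :: 'a \<Rightarrow>\<^sub>L real) (x n)) \<longlonglongrightarrow> f p"
proof (rule ccontr)
  assume "\<not> ?thesis"
  then obtain \<epsilon> where \<epsilon>: "\<epsilon> > 0" and fr: "\<not> (\<forall>\<^sub>F n in sequentially. dist (f (x n)) (f p) < \<epsilon>)"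
    unfolding tendsto_iff by blast
  \<comment> \<open>a subsequence, as a filter, along which \<open>f\<close> stays away from \<open>f p\<close>\<close>
  define P where "P = principal {n. dist (f (x n)) (f p) \<ge> \<epsilon>}"
  define F where "F = filtermap x (inf sequentially P)"
  have nb: "inf sequentially P \<noteq> bot"
  proof
    assume "inf sequentially P = bot"
    then have "eventually (\<lambda>_. False) (inf sequentially P)" by simp
    with fr show False unfolding P_def eventually_inf_principal by (simp add: not_le)
  qed
  have "\<forall>\<^sub>F y in F. y \<in> C" unfolding F_def eventually_filtermap using x by simp
  with weak_cluster_point_exists[OF C] nb obtain q where q: "weak_cluster_point F q"
    unfolding F_def by (metis filtermap_bot_iff)
  have cl: "\<exists>\<^sub>F n in inf sequentially P. \<bar>g (x n) - g q\<bar> < \<delta>" if "\<delta> > 0" for \<delta> and g :: "'a \<Rightarrow>\<^sub>L real"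
  proof -
    have "\<exists>\<^sub>F y in F. \<forall>g\<in>{g}. \<bar>blinfun_apply g y - blinfun_apply g q\<bar> < \<delta>"
      using q that unfolding weak_cluster_point_def by blast
    then show ?thesis unfolding F_def frequently_def eventually_filtermap by simp
  qed
  have "h k q = h k p" for k
  proof (rule ccontr)
    assume ne: "h k q \<noteq> h k p"
    define \<delta> where "\<delta> = \<bar>h k q - h k p\<bar> / 2"
    have d: "\<delta> > 0" using ne by (simp add: \<delta>_def)
    have "\<forall>\<^sub>F n in sequentially. dist (h k (x n)) (h k p) < \<delta>" using conv[of k] d by (simp add: tendsto_iff)
    then have "\<forall>\<^sub>F n in inf sequentially P. dist (h k (x n)) (h k p) < \<delta>"
      by (rule filter_leD[OF inf_le1])
    with cl[OF d, of "h k"] have "\<exists>\<^sub>F n in inf sequentially P. \<bar>h k (x n) - h k q\<bar> < \<delta> \<and> dist (h k (x n)) (h k p) < \<delta>"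
      by (simp add: frequently_eventually_frequently)
    then obtain n where "\<bar>h k (x n) - h k q\<bar> < \<delta>" "dist (h k (x n)) (h k p) < \<delta>"
      by (auto dest: frequently_ex)
    moreover have "\<bar>h k q - h k p\<bar> \<le> \<bar>h k (x n) - h k q\<bar> + \<bar>h k (x n) - h k p\<bar>" by linarith
    ultimately show False unfolding \<delta>_def dist_real_def by simp
  qed
  then have "q = p" by (rule sep)
  have "\<forall>\<^sub>F n in inf sequentially P. dist (f (x n)) (f p) \<ge> \<epsilon>"
    unfolding P_def eventually_inf_principal by simp
  with cl[OF \<epsilon>, of f] have "\<exists>\<^sub>F n in inf sequentially P. \<bar>f (x n) - f q\<bar> < \<epsilon> \<and> dist (f (x n)) (f p) \<ge> \<epsilon>"
    by (simp add: frequently_eventually_frequently)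
  then show False using \<open>q = p\<close> by (auto dest: frequently_ex simp: dist_real_def)
qed

lemma weakly_compact_closed:
  fixes C :: "'a::real_normed_vector set"
  assumes C: "compactin weak_topology C"
  shows "closed C"
  unfolding closed_sequential_limits
proof (intro allI impI)
  fix x l assume x: "(\<forall>n. x n \<in> C) \<and> x \<longlonglongrightarrow> l"
  define F where "F = filtermap x sequentially"
  have "F \<noteq> bot" "\<forall>\<^sub>F y in F. y \<in> C" using x by (auto simp: F_def filtermap_bot_iff eventually_filtermap)
  then obtain p where p: "p \<in> C" "weak_cluster_point F p" using weak_cluster_point_exists[OF C] by blast
  have "p \<in> cball l \<epsilon>" if "\<epsilon> > 0" for \<epsilon>
  proof (rule weak_cluster_point_closed_convex[OF p(2)])
    show "\<forall>\<^sub>F y in F. y \<in> cball l \<epsilon>"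
    proof -
      have "\<forall>\<^sub>F n in sequentially. dist (x n) l < \<epsilon>" using x that by (simp add: tendsto_iff)
      then show ?thesis unfolding F_def eventually_filtermap
        by (rule eventually_mono) (simp add: dist_commute)
    qed
  qed auto
  then have "dist l p \<le> 0 + \<epsilon>" if "\<epsilon> > 0" for \<epsilon> using that by simp
  then have "dist l p \<le> 0" by (rule field_le_epsilon)
  then have "p = l" by simp
  with p(1) show "l \<in> C" by simp
qed

text \<open>
  Each functional is bounded on \<open>C\<close>, so the closed sets of functionals bounded by \<open>k\<close> on \<open>C\<close> cover
  the dual. By Baire's theorem one of them contains a ball, which bounds the norms on \<open>C\<close> by means of
  norming functionals.
\<close>

lemma weakly_compact_bounded:
  fixes C :: "'a::real_normed_vector set"
  assumes C: "compactin weak_topology C"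
  shows "bounded C"
proof -
  define A where "A k = (\<Inter>x\<in>C. {f::'a \<Rightarrow>\<^sub>L real. \<bar>f x\<bar> \<le> real k})" for k
  have clA: "closed (A k)" for k
    unfolding A_def by (intro closed_INT ballI closed_Collect_le continuous_intros)
  have "f \<in> (\<Union>k. A k)" for f
  proof -
    have "compact ((\<lambda>g. g f) ` (\<lambda>x (f::'a \<Rightarrow>\<^sub>L real). blinfun_apply f x) ` C)"
      by (intro compact_continuous_image compact_evaluations[OF C])
        (rule continuous_on_subset[OF continuous_on_product_coordinates subset_UNIV])
    then have "bounded (blinfun_apply f ` C)" by (simp add: image_image compact_imp_bounded)
    then obtain b where "\<forall>x\<in>C. \<bar>f x\<bar> \<le> b" unfolding bounded_iff by auto
    moreover obtain k where "b \<le> real k" using real_arch_simple by blast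
    ultimately show ?thesis unfolding A_def by (auto intro: order_trans)
  qed
  then have "\<Union>(range A) = UNIV" by blast
  then have "interior (\<Union>(range A)) \<noteq> {}" by simp
  have "\<exists>k. interior (A k) \<noteq> {}"
  proof (rule ccontr)
    assume "\<not> ?thesis"
    then have "euclidean interior_of \<Union>(range A) = {}"
      using clA by (intro Baire_category_alt) (auto simp: completely_metrizable_space_euclidean)
    with \<open>interior (\<Union>(range A)) \<noteq> {}\<close> show False by simp
  qed
  then obtain k g where "g \<in> interior (A k)" by blast
  then obtain r where r: "r > 0" "cball g r \<subseteq> A k"
    using mem_interior_cball by blast
  have "norm x \<le> 2 * real k / r" if x: "x \<in> C" for x
  proof -
    obtain f :: "'a \<Rightarrow>\<^sub>L real" where f: "\<forall>y. \<bar>f y\<bar> \<le> norm y" "f x = norm x"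
      using norming_functional by blast
    have "norm f \<le> 1" using f(1) by (intro norm_blinfun_bound) auto
    then have "g + r *\<^sub>R f \<in> cball g r" "g \<in> cball g r"
      using r(1) by (auto simp: dist_norm mult_left_le)
    then have "\<bar>(g + r *\<^sub>R f) x\<bar> \<le> k" "\<bar>g x\<bar> \<le> k" using r(2) x unfolding A_def by blast+
    then have "r * norm x \<le> 2 * real k"
      using f(2) by (simp add: blinfun.add_left blinfun.scaleR_left)
    then show ?thesis using r(1) by (simp add: field_simps)
  qed
  then show ?thesis unfolding bounded_iff by blast
qed

section \<open>Minimal invariant sets\<close>

text \<open>
  Minimality refers to norm-closed sets, so that it can be applied to sets given by norm estimates.
  Weak cluster points are found in the weakly compact set \<open>C\<close> and lie in \<open>K\<close> by Mazur's theorem.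
\<close>

locale minimal_invariant_set =
  fixes C K :: "'a::real_normed_vector set" and T :: "'a \<Rightarrow> 'a"
  assumes weakly_compact: "compactin weak_topology C" and subset: "K \<subseteq> C"
    and nonempty: "K \<noteq> {}" and closed: "closed K" and convex: "convex K"
    and self_map: "x \<in> K \<Longrightarrow> T x \<in> K"
    and nonexpansive: "x \<in> K \<Longrightarrow> y \<in> K \<Longrightarrow> norm (T x - T y) \<le> norm (x - y)"
    and minimal: "L \<noteq> {} \<Longrightarrow> L \<subseteq> K \<Longrightarrow> closed L \<Longrightarrow> convex L \<Longrightarrow> T ` L \<subseteq> L \<Longrightarrow> L = K"

text \<open>
  A chain of closed convex invariant sets generates a filter, and a weak cluster point of this
  filter lies in every member of the chain.
\<close>

lemma minimal_invariant_set_exists: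
  fixes C :: "'a::real_normed_vector set"
  assumes C: "compactin weak_topology C" "C \<noteq> {}" "convex C" "T \<in> C \<rightarrow> C" "nonexpansive_on C T"
  shows "\<exists>K. minimal_invariant_set C K T"
proof -
  define S where "S = {K. K \<noteq> {} \<and> K \<subseteq> C \<and> closed K \<and> convex K \<and> T ` K \<subseteq> K}"
  have CS: "C \<in> S" using C weakly_compact_closed[OF C(1)] by (auto simp: S_def)
  have "\<exists>K\<in>S. \<forall>L\<in>S. K \<supseteq> L \<longrightarrow> L = K"
  proof (rule predicate_Zorn)
    show "partial_order_on S (relation_of (\<lambda>x y. x \<supseteq> y) S)"
      by (rule partial_order_on_relation_ofI) auto
  next
    fix \<C> assume ch: "\<C> \<in> Chains (relation_of (\<lambda>x y. x \<supseteq> y) S)"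
    have sub: "\<C> \<subseteq> S" and tot: "\<And>K L. K \<in> \<C> \<Longrightarrow> L \<in> \<C> \<Longrightarrow> K \<subseteq> L \<or> L \<subseteq> K"
      using ch unfolding Chains_def relation_of_def by auto
    show "\<exists>U\<in>S. \<forall>K\<in>\<C>. K \<supseteq> U"
    proof (cases "\<C> = {}")
      case True
      then show ?thesis using CS by auto
    next
      case False
      define F where "F = (INF K\<in>\<C>. principal K)"
      have inF: "\<forall>\<^sub>F x in F. x \<in> K" if "K \<in> \<C>" for K
        unfolding F_def using that by (intro eventually_INF1[OF that]) (simp add: eventually_principal)
      have "F \<noteq> bot"
        unfolding F_def
      proof (subst INF_filter_bot_base)
        show "\<exists>M\<in>\<C>. principal M \<le> inf (principal K) (principal L)" if "K \<in> \<C>" "L \<in> \<C>" for K L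
          using tot[OF that] that by (auto simp: Int_absorb1 Int_absorb2)
        show "\<not> (\<exists>K\<in>\<C>. principal K = bot)"
          using sub by (auto simp: S_def principal_eq_bot_iff)
      qed
      obtain K0 where K0: "K0 \<in> \<C>" using False by blast
      have "K0 \<subseteq> C" using K0 sub by (auto simp: S_def)
      then have "\<forall>\<^sub>F x in F. x \<in> C" using inF[OF K0] by (auto elim: eventually_mono)
      with \<open>F \<noteq> bot\<close> obtain p where p: "p \<in> C" "weak_cluster_point F p"
        using weak_cluster_point_exists[OF C(1)] by blast
      have "p \<in> K" if "K \<in> \<C>" for K
        using that sub inF by (intro weak_cluster_point_closed_convex[OF p(2)]) (auto simp: S_def)
      then have "p \<in> \<Inter>\<C>" by blast
      moreover have "\<Inter>\<C> \<subseteq> C" using K0 sub by (auto simp: S_def)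
      moreover have "closed (\<Inter>\<C>)" "convex (\<Inter>\<C>)"
        using sub by (auto simp: S_def intro!: closed_Inter convex_Inter)
      moreover have "T ` \<Inter>\<C> \<subseteq> \<Inter>\<C>" using sub unfolding S_def by blast
      ultimately have "\<Inter>\<C> \<in> S" by (auto simp: S_def)
      then show ?thesis by blast
    qed
  qed
  then obtain K where K: "K \<in> S" "\<And>L. L \<in> S \<Longrightarrow> L \<subseteq> K \<Longrightarrow> L = K" by blast
  have "minimal_invariant_set C K T"
  proof
    show "norm (T x - T y) \<le> norm (x - y)" if "x \<in> K" "y \<in> K" for x y
      using that K(1) C(5) by (auto simp: S_def nonexpansive_on_def)
    show "L = K" if "L \<noteq> {}" "L \<subseteq> K" "closed L" "convex L" "T ` L \<subseteq> L" for L
      using that K(1) by (intro K(2)) (auto simp: S_def)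
  qed (use C K in \<open>auto simp: S_def\<close>)
  then show ?thesis ..
qed

context minimal_invariant_set
begin

lemma bounded: "bounded K"
  using weakly_compact_bounded[OF weakly_compact] subset by (rule bounded_subset)

lemma norm_diff_le_diameter: "x \<in> K \<Longrightarrow> y \<in> K \<Longrightarrow> norm (x - y) \<le> diameter K"
  using diameter_bounded_bound[OF bounded] by (simp add: dist_norm)

lemma cluster_point:
  assumes "\<And>n::nat. x n \<in> K"
  shows "\<exists>p\<in>K. weak_cluster_point (filtermap x sequentially) p"
proof -
  have ev: "\<forall>\<^sub>F y in filtermap x sequentially. y \<in> K" using assms by (simp add: eventually_filtermap)
  then have "\<forall>\<^sub>F y in filtermap x sequentially. y \<in> C" by (rule eventually_mono) (use subset in blast)
  with weak_cluster_point_exists[OF weakly_compact] obtain p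
    where "weak_cluster_point (filtermap x sequentially) p"
    by (metis filtermap_bot_iff sequentially_bot)
  with weak_cluster_point_closed_convex[OF this closed convex ev] show ?thesis by blast
qed

lemma closed_convex_hull_image: "closure (convex hull (T ` K)) = K"
proof (rule minimal)
  show "closure (convex hull (T ` K)) \<noteq> {}" using nonempty by simp
  show sub: "closure (convex hull (T ` K)) \<subseteq> K"
    using self_map by (intro closure_minimal closed hull_minimal convex) auto
  show "convex (closure (convex hull (T ` K)))" by (intro convex_closure convex_convex_hull)
  have "T ` closure (convex hull (T ` K)) \<subseteq> T ` K" using sub by blast
  also have "\<dots> \<subseteq> closure (convex hull (T ` K))"
    using hull_subset[of "T ` K" convex] closure_subset[of "convex hull (T ` K)"] by (rule order_trans)
  finally show "T ` closure (convex hull (T ` K)) \<subseteq> closure (convex hull (T ` K))" .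
qed simp

text \<open>
  If the whole of \<open>K\<close> lies within \<open>r\<close> of \<open>z\<close>, then \<open>T ` K\<close> lies within \<open>r\<close> of \<open>T z\<close>, and so does its
  closed convex hull, which is \<open>K\<close> again. So the points with this property form an invariant set.
\<close>

lemma all_points_diametral:
  assumes z: "z \<in> K" and r: "\<And>u. u \<in> K \<Longrightarrow> norm (z - u) \<le> r"
  shows "diameter K \<le> r"
proof -
  define L where "L = K \<inter> (\<Inter>u\<in>K. cball u r)"
  have "L = K"
  proof (rule minimal)
    show "L \<noteq> {}" using z r by (auto simp: L_def dist_norm norm_minus_commute)
    show "L \<subseteq> K" by (simp add: L_def)
    show "closed L" unfolding L_def by (intro closed_Int closed closed_INT ballI closed_cball)
    show "convex L" unfolding L_def by (intro convex_Int convex convex_INT convex_cball)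
    show "T ` L \<subseteq> L"
    proof
      fix y assume "y \<in> T ` L"
      then obtain v where v: "v \<in> L" "y = T v" by blast
      have vK: "v \<in> K" and vr: "\<And>u. u \<in> K \<Longrightarrow> norm (v - u) \<le> r"
        using v(1) by (auto simp: L_def dist_norm norm_minus_commute)
      have "T ` K \<subseteq> cball (T v) r"
        using nonexpansive[OF vK] vr by (force simp: dist_norm intro: order_trans)
      then have "closure (convex hull (T ` K)) \<subseteq> cball (T v) r"
        by (intro closure_minimal hull_minimal closed_cball convex_cball)
      then have "K \<subseteq> cball (T v) r" by (simp add: closed_convex_hull_image)
      then show "y \<in> L" using v vK self_map by (auto simp: L_def dist_commute)
    qed
  qed
  have "norm (x - y) \<le> r" if "x \<in> K" "y \<in> K" for x y
  proof -
    have "x \<in> L" using \<open>L = K\<close> that by simp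
    then show ?thesis using that by (auto simp: L_def dist_norm norm_minus_commute)
  qed
  then show ?thesis using nonempty by (intro diameter_le) auto
qed

text \<open>
  Otherwise some sequence of approximate fixed points stays within \<open>r < diameter K\<close> of \<open>u\<close>. The points
  from which the sequence is eventually at distance at most about \<open>r\<close> form an invariant closed convex
  set, hence all of \<open>K\<close>. A weak cluster point of the sequence is then within \<open>r\<close> of all of \<open>K\<close>, which
  contradicts \<open>all_points_diametral\<close>.
\<close>

lemma goebel_karlovitz:
  assumes u: "u \<in> K" and \<epsilon>: "\<epsilon> > 0"
  shows "\<exists>\<delta>>0. \<forall>z\<in>K. norm (T z - z) \<le> \<delta> \<longrightarrow> diameter K - \<epsilon> \<le> norm (z - u)"
proof (rule ccontr)
  define r where "r = diameter K - \<epsilon>"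
  assume "\<not> ?thesis"
  then have neg: "\<exists>z\<in>K. norm (T z - z) \<le> \<delta> \<and> norm (z - u) < r" if "\<delta> > 0" for \<delta>
    using that unfolding r_def by (auto simp: not_le)
  have "\<forall>n. \<exists>z. z \<in> K \<and> norm (T z - z) \<le> 1 / real (Suc n) \<and> norm (z - u) < r"
  proof
    fix n
    have "1 / real (Suc n) > 0" by simp
    from neg[OF this] show "\<exists>z. z \<in> K \<and> norm (T z - z) \<le> 1 / real (Suc n) \<and> norm (z - u) < r" by blast
  qed
  from choice[OF this] obtain z where z: "\<And>n. z n \<in> K" "\<And>n. norm (T (z n) - z n) \<le> 1 / real (Suc n)"
    "\<And>n. norm (z n - u) < r" by blast
  define L where "L = {v \<in> K. \<forall>\<eta>>0. \<forall>\<^sub>F n in sequentially. norm (z n - v) \<le> r + \<eta>}"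
  have L: "L = K"
  proof (rule minimal)
    have "u \<in> L" using u z(3) by (auto simp: L_def less_imp_le intro!: always_eventually add_increasing2)
    then show "L \<noteq> {}" by blast
    show "L \<subseteq> K" by (auto simp: L_def)
    have "closure L \<subseteq> L"
    proof
      fix v assume v: "v \<in> closure L"
      have "v \<in> K" using v closed \<open>L \<subseteq> K\<close> closure_minimal by blast
      moreover have "\<forall>\<^sub>F n in sequentially. norm (z n - v) \<le> r + \<eta>" if "\<eta> > 0" for \<eta>
      proof -
        have h: "\<eta> / 2 > 0" using that by simp
        then obtain w where w: "w \<in> L" "dist w v < \<eta> / 2" using v closure_approachable by blast
        then have "\<forall>\<^sub>F n in sequentially. norm (z n - w) \<le> r + \<eta> / 2" using h by (simp add: L_def)
        then show ?thesis
        proof eventually_elim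
          case (elim n)
          have "norm (z n - v) \<le> norm (z n - w) + norm (w - v)" using norm_triangle_ineq[of "z n - w" "w - v"] by simp
          with elim w(2) show ?case by (simp add: dist_norm)
        qed
      qed
      ultimately show "v \<in> L" by (simp add: L_def)
    qed
    then show "closed L" by (simp add: closure_subset_eq)
    show "convex L"
    proof (rule convexI)
      fix v w and a b :: real assume vw: "v \<in> L" "w \<in> L" and ab: "0 \<le> a" "0 \<le> b" "a + b = 1"
      have "\<forall>\<^sub>F n in sequentially. norm (z n - (a *\<^sub>R v + b *\<^sub>R w)) \<le> r + \<eta>" if "\<eta> > 0" for \<eta>
      proof -
        have "\<forall>\<^sub>F n in sequentially. norm (z n - v) \<le> r + \<eta>" "\<forall>\<^sub>F n in sequentially. norm (z n - w) \<le> r + \<eta>"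
          using vw that by (auto simp: L_def)
        then show ?thesis
        proof eventually_elim
          case (elim n)
          have "a *\<^sub>R v + b *\<^sub>R w \<in> cball (z n) (r + \<eta>)"
            using elim ab by (intro convexD[OF convex_cball]) (auto simp: dist_norm)
          then show ?case by (simp add: dist_norm)
        qed
      qed
      moreover have "a *\<^sub>R v + b *\<^sub>R w \<in> K" using vw ab by (intro convexD[OF convex]) (auto simp: L_def)
      ultimately show "a *\<^sub>R v + b *\<^sub>R w \<in> L" by (simp add: L_def)
    qed
    show "T ` L \<subseteq> L"
    proof
      fix y assume "y \<in> T ` L"
      then obtain v where v: "v \<in> L" "y = T v" by blast
      then have vK: "v \<in> K" by (simp add: L_def)
      have "\<forall>\<^sub>F n in sequentially. norm (z n - y) \<le> r + \<eta>" if "\<eta> > 0" for \<eta>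
      proof -
        have h: "\<eta> / 2 > 0" using that by simp
        have "\<forall>\<^sub>F n in sequentially. norm (z n - v) \<le> r + \<eta> / 2" using v h by (simp add: L_def)
        moreover have "\<forall>\<^sub>F n in sequentially. 1 / real (Suc n) < \<eta> / 2"
          using LIMSEQ_Suc[OF lim_1_over_n[where 'a = real]] h by (rule order_tendstoD(2))
        ultimately show ?thesis
        proof eventually_elim
          case (elim n)
          have "z n - y = (T (z n) - T v) - (T (z n) - z n)" using v by simp
          then have "norm (z n - y) \<le> norm (T (z n) - T v) + norm (T (z n) - z n)"
            by (metis norm_triangle_ineq4)
          also have "\<dots> \<le> norm (z n - v) + 1 / real (Suc n)"
            by (intro add_mono nonexpansive z vK)
          finally show ?case using elim by simp
        qed
      qed
      then show "y \<in> L" using v vK self_map by (simp add: L_def)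
    qed
  qed
  obtain p where p: "p \<in> K" "weak_cluster_point (filtermap z sequentially) p"
    using cluster_point[of z] z(1) by blast
  have near: "norm (p - v) \<le> r + \<eta>" if "v \<in> K" "\<eta> > 0" for v \<eta>
  proof -
    have "\<forall>\<^sub>F n in sequentially. norm (z n - v) \<le> r + \<eta>" using that L by (auto simp: L_def)
    then have "\<forall>\<^sub>F y in filtermap z sequentially. y \<in> cball v (r + \<eta>)"
      by (simp add: eventually_filtermap dist_norm norm_minus_commute)
    then have "p \<in> cball v (r + \<eta>)"
      by (intro weak_cluster_point_closed_convex[OF p(2)] closed_cball convex_cball)
    then show ?thesis by (simp add: dist_norm norm_minus_commute)
  qed
  have "norm (p - v) \<le> r" if "v \<in> K" for v using near[OF that] by (rule field_le_epsilon)
  then have "diameter K \<le> r" by (rule all_points_diametral[OF p(1)])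
  then show False using \<epsilon> by (simp add: r_def)
qed

end

text \<open>
  Picard iterates of the contraction \<open>y \<mapsto> (1 - s) T y + s x\<close>. They stay in every convex invariant set
  that contains \<open>x\<close>, without a limit process, which matters for families of double sequences where no
  closedness is available.
\<close>

primrec damped_iterate :: "('a::real_vector \<Rightarrow> 'a) \<Rightarrow> real \<Rightarrow> 'a \<Rightarrow> nat \<Rightarrow> 'a" where
  "damped_iterate T s x 0 = x"
| "damped_iterate T s x (Suc k) = (1 - s) *\<^sub>R T (damped_iterate T s x k) + s *\<^sub>R x"

lemma (in minimal_invariant_set) damped_iterate_in:
  assumes "x \<in> K" "0 < s" "s < 1"
  shows "damped_iterate T s x k \<in> K"
proof (induction k)
  case (Suc k)
  then show ?case
    unfolding damped_iterate.simps using assms self_map by (intro convexD[OF convex]) auto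
qed (use assms in simp)

text \<open>
  One choice of \<open>s\<close> and \<open>k\<close> serves all starting points, because \<open>K\<close> is bounded.
\<close>

lemma (in minimal_invariant_set) damped_iterate_approximate_fixed_point:
  assumes \<delta>: "\<delta> > 0"
  shows "\<exists>s k. 0 < s \<and> s < 1 \<and> (\<forall>x\<in>K. norm (T (damped_iterate T s x k) - damped_iterate T s x k) \<le> \<delta>)"
proof -
  define b where "b = diameter K + 1"
  have b: "b > 0" using diameter_ge_0[OF bounded] by (simp add: b_def)
  \<comment> \<open>the damping causes an error of at most \<open>s * b\<close>\<close>
  define s where "s = min (1 / 2) (\<delta> / (2 * b))"
  have s: "0 < s" "s < 1" "s * b \<le> \<delta> / 2"
    using \<delta> b by (auto simp: s_def min_def field_simps)
  have diam: "norm (x - y) \<le> b" if "x \<in> K" "y \<in> K" for x y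
    using norm_diff_le_diameter[OF that] by (simp add: b_def)
  have "(\<lambda>k. (1 - s) ^ k * b) \<longlonglongrightarrow> 0 * b"
    using s by (intro tendsto_mult LIMSEQ_realpow_zero tendsto_const) auto
  then have "\<forall>\<^sub>F k in sequentially. (1 - s) ^ k * b < \<delta> / 2"
    using \<delta> by (intro order_tendstoD(2)) auto
  then obtain k where k: "(1 - s) ^ k * b < \<delta> / 2"
    by (meson eventually_sequentially order_refl)
  have "norm (T (damped_iterate T s x k) - damped_iterate T s x k) \<le> \<delta>" if x: "x \<in> K" for x
  proof -
    let ?z = "damped_iterate T s x"
    have zK: "?z j \<in> K" for j using damped_iterate_in[OF x s(1,2)] .
    have step: "norm (?z (Suc j) - ?z j) \<le> (1 - s) ^ j * b" for j
    proof (induction j)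
      case 0
      have "?z (Suc 0) - ?z 0 = (1 - s) *\<^sub>R (T x - x)" by (simp add: algebra_simps)
      then have "norm (?z (Suc 0) - ?z 0) = (1 - s) * norm (T x - x)" using s by simp
      also have "\<dots> \<le> 1 * b" using s x self_map b by (intro mult_mono diam) auto
      finally show ?case by simp
    next
      case (Suc j)
      have "?z (Suc (Suc j)) - ?z (Suc j) = (1 - s) *\<^sub>R (T (?z (Suc j)) - T (?z j))"
        by (simp add: algebra_simps)
      then have "norm (?z (Suc (Suc j)) - ?z (Suc j)) = (1 - s) * norm (T (?z (Suc j)) - T (?z j))"
        using s by simp
      also have "\<dots> \<le> (1 - s) * ((1 - s) ^ j * b)"
        using s nonexpansive[OF zK zK, of "Suc j" j] Suc by (intro mult_left_mono order_trans[OF _ Suc]) auto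
      finally show ?case by simp
    qed
    have "T (?z k) - ?z (Suc k) = s *\<^sub>R (T (?z k) - x)" by (simp add: algebra_simps)
    then have "norm (T (?z k) - ?z (Suc k)) = s * norm (T (?z k) - x)" using s by simp
    also have "\<dots> \<le> s * b" using s x zK self_map by (intro mult_left_mono diam) auto
    finally have "norm (T (?z k) - ?z (Suc k)) \<le> \<delta> / 2" using s by simp
    moreover have "norm (T (?z k) - ?z k) \<le> norm (T (?z k) - ?z (Suc k)) + norm (?z (Suc k) - ?z k)"
      using norm_triangle_ineq[of "T (?z k) - ?z (Suc k)" "?z (Suc k) - ?z k"] by simp
    ultimately show ?thesis using step[of k] k by simp
  qed
  with s show ?thesis by blast
qed

section \<open>Finite coordinate projections\<close>

definition coordinate :: "(nat \<Rightarrow> 'a::real_normed_vector) \<Rightarrow> nat \<Rightarrow> 'a \<Rightarrow> real" where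
  "coordinate e k x = (THE a. (\<lambda>n. a n *\<^sub>R e n) sums x) k"

definition coordinate_projection :: "(nat \<Rightarrow> 'a::real_normed_vector) \<Rightarrow> nat set \<Rightarrow> 'a \<Rightarrow> 'a" where
  "coordinate_projection e A x = (\<Sum>k\<in>A. coordinate e k x *\<^sub>R e k)"

lemma coordinate_sums:
  assumes "schauder_basis e"
  shows "(\<lambda>n. coordinate e n x *\<^sub>R e n) sums x"
proof -
  have "\<exists>!a. (\<lambda>n. a n *\<^sub>R e n) sums x" using assms by (simp add: schauder_basis_def)
  from theI'[OF this] show ?thesis by (simp add: coordinate_def)
qed

lemma coordinate_eqI:
  assumes "schauder_basis e" "(\<lambda>n. a n *\<^sub>R e n) sums x"
  shows "coordinate e k x = a k"
proof -
  have *: "\<exists>!a. (\<lambda>n. a n *\<^sub>R e n) sums x" using assms by (simp add: schauder_basis_def)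
  have "(THE b. (\<lambda>n. b n *\<^sub>R e n) sums x) = a" by (rule the1_equality[OF *]) (rule assms(2))
  then show ?thesis by (simp add: coordinate_def)
qed

lemma linear_coordinate:
  assumes "schauder_basis e"
  shows "linear (coordinate e k)"
proof (rule linearI)
  fix x y
  have "(\<lambda>n. (coordinate e n x + coordinate e n y) *\<^sub>R e n) sums (x + y)"
    using sums_add[OF coordinate_sums coordinate_sums, OF assms assms] by (simp add: scaleR_left_distrib)
  from coordinate_eqI[OF assms this] show "coordinate e k (x + y) = coordinate e k x + coordinate e k y" .
next
  fix r x
  have "(\<lambda>n. (r * coordinate e n x) *\<^sub>R e n) sums (r *\<^sub>R x)"
    using sums_scaleR_right[OF coordinate_sums[OF assms]] by simp
  from coordinate_eqI[OF assms this] show "coordinate e k (r *\<^sub>R x) = r *\<^sub>R coordinate e k x" by simp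
qed

text \<open>
  Changing the signs of finitely many coordinates costs a factor \<open>D\<close>, so projections onto and along
  finite sets of coordinates cost \<open>(1 + D) / 2\<close>, as averages of the identity and a sign change.
\<close>

locale sign_bounded_basis =
  fixes e :: "nat \<Rightarrow> 'a::real_normed_vector" and D :: real
  assumes basis: "schauder_basis e" and D_nonneg: "D \<ge> 0"
    and sign_change_le: "finite A \<Longrightarrow> norm (x - 2 *\<^sub>R coordinate_projection e A x) \<le> D * norm x"
begin

abbreviation "P \<equiv> coordinate_projection e"

lemma linear_projection: "linear (P A)"
  unfolding coordinate_projection_def
  by (intro linear_compose_sum ballI)
    (auto intro!: linearI simp: linear_add[OF linear_coordinate[OF basis]]
      linear_scale[OF linear_coordinate[OF basis]] scaleR_left_distrib)

lemmas projection_diff = linear_diff[OF linear_projection]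

lemma projection_disjoint_union:
  "finite A \<Longrightarrow> finite B \<Longrightarrow> A \<inter> B = {} \<Longrightarrow> P (A \<union> B) x = P A x + P B x"
  by (simp add: coordinate_projection_def sum.union_disjoint)

lemma projection_tendsto: "(\<lambda>N. P {..<N} x) \<longlonglongrightarrow> x"
  using coordinate_sums[OF basis, of x] by (simp add: sums_def coordinate_projection_def)

lemma norm_projection_le: "finite A \<Longrightarrow> norm (P A x) \<le> (1 + D) / 2 * norm x"
proof -
  assume A: "finite A"
  have "2 *\<^sub>R P A x = x - (x - 2 *\<^sub>R P A x)" by simp
  then have "norm (2 *\<^sub>R P A x) \<le> norm x + norm (x - 2 *\<^sub>R P A x)" by (metis norm_triangle_ineq4)
  then show ?thesis using sign_change_le[OF A, of x] by (simp add: field_simps)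
qed

lemma norm_complementary_projection_le: "finite A \<Longrightarrow> norm (x - P A x) \<le> (1 + D) / 2 * norm x"
proof -
  assume A: "finite A"
  have "2 *\<^sub>R (x - P A x) = x + (x - 2 *\<^sub>R P A x)" by (simp add: algebra_simps scaleR_2)
  then have "norm (2 *\<^sub>R (x - P A x)) \<le> norm x + norm (x - 2 *\<^sub>R P A x)" by (metis norm_triangle_ineq)
  then show ?thesis unfolding norm_scaleR using sign_change_le[OF A, of x] by (simp add: field_simps)
qed

lemma basis_vector_nonzero: "e k \<noteq> 0"
proof
  assume 0: "e k = 0"
  have "(\<lambda>n. (0::real) *\<^sub>R e n) sums 0" by simp
  moreover have "(\<lambda>n. (if n = k then 1 else 0::real) *\<^sub>R e n) = (\<lambda>n. 0)" using 0 by auto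
  then have "(\<lambda>n. (if n = k then 1 else 0::real) *\<^sub>R e n) sums 0" by simp
  ultimately show False
    using coordinate_eqI[OF basis, of "\<lambda>n. 0" 0 k]
      coordinate_eqI[OF basis, of "\<lambda>n. if n = k then 1 else 0" 0 k] by simp
qed

lemma bounded_linear_coordinate: "bounded_linear (coordinate e k)"
proof (rule bounded_linear_intro)
  show "coordinate e k (x + y) = coordinate e k x + coordinate e k y" for x y
    by (rule linear_add[OF linear_coordinate[OF basis]])
  show "coordinate e k (r *\<^sub>R x) = r *\<^sub>R coordinate e k x" for r x
    by (rule linear_scale[OF linear_coordinate[OF basis]])
  fix x
  have "norm (P {k} x) \<le> (1 + D) / 2 * norm x" by (rule norm_projection_le) simp
  then show "norm (coordinate e k x) \<le> norm x * ((1 + D) / 2 / norm (e k))"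
    using basis_vector_nonzero[of k] by (simp add: coordinate_projection_def field_simps)
qed

definition coordinate_functional :: "nat \<Rightarrow> 'a \<Rightarrow>\<^sub>L real" where
  "coordinate_functional k = Blinfun (coordinate e k)"

lemma coordinate_functional_apply [simp]: "blinfun_apply (coordinate_functional k) x = coordinate e k x"
  by (simp add: coordinate_functional_def bounded_linear_Blinfun_apply bounded_linear_coordinate)

lemma coordinates_determine:
  assumes "\<And>k. coordinate e k x = coordinate e k y"
  shows "x = y"
  using coordinate_sums[OF basis, of x] coordinate_sums[OF basis, of y]
  unfolding assms by (rule sums_unique2)

lemma projection_tendsto_of_coordinates:
  assumes "\<And>k. (\<lambda>n. coordinate e k (x n)) \<longlonglongrightarrow> coordinate e k p" "finite A"
  shows "(\<lambda>n. norm (P A (x n - p))) \<longlonglongrightarrow> 0"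
proof -
  have "(\<lambda>n. P A (x n) - P A p) \<longlonglongrightarrow> P A p - P A p"
    unfolding coordinate_projection_def by (intro tendsto_intros assms)
  then show ?thesis by (simp add: projection_diff tendsto_norm_zero)
qed

lemma projection_blocks_small:
  assumes "\<eta> > 0"
  shows "\<exists>M. \<forall>N\<ge>M. norm (x - P {..<N} x) \<le> \<eta> \<and> norm (P {M..<N} x) \<le> \<eta>"
proof -
  have "\<forall>\<^sub>F N in sequentially. dist (P {..<N} x) x < \<eta> / 2"
    using assms by (intro tendstoD[OF projection_tendsto]) simp
  then obtain M where M: "\<And>N. N \<ge> M \<Longrightarrow> norm (x - P {..<N} x) < \<eta> / 2"
    unfolding eventually_sequentially dist_norm by (metis norm_minus_commute)
  have "norm (x - P {..<N} x) \<le> \<eta> \<and> norm (P {M..<N} x) \<le> \<eta>" if N: "N \<ge> M" for N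
  proof -
    have "{..<N} = {..<M} \<union> {M..<N}" using N by auto
    then have "P {..<N} x = P {..<M} x + P {M..<N} x"
      by (simp add: projection_disjoint_union ivl_disj_int)
    then have "P {M..<N} x = (x - P {..<M} x) - (x - P {..<N} x)" by simp
    then have "norm (P {M..<N} x) \<le> norm (x - P {..<M} x) + norm (x - P {..<N} x)"
      by (metis norm_triangle_ineq4)
    with M[OF N] M[OF order_refl] assms show ?thesis by simp
  qed
  then show ?thesis by blast
qed

lemma weak_cluster_point_projection:
  fixes f :: "'a \<Rightarrow>\<^sub>L real"
  assumes q: "weak_cluster_point F q" and \<eta>: "\<eta> > 0"
  shows "\<exists>\<^sub>F y in F. \<bar>f y - f q\<bar> < \<eta> \<and> norm (P {..<N} (y - q)) \<le> \<eta>"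
proof -
  define s where "s = (\<Sum>k<N. norm (e k))"
  have s: "s \<ge> 0" by (simp add: s_def sum_nonneg)
  define \<delta> where "\<delta> = \<eta> / (1 + s)"
  have \<delta>: "\<delta> > 0" "\<delta> \<le> \<eta>" "\<delta> * s \<le> \<eta>"
    using \<eta> s by (auto simp: \<delta>_def field_simps)
  have "\<exists>\<^sub>F y in F. \<forall>g\<in>insert f (coordinate_functional ` {..<N}). \<bar>blinfun_apply g y - blinfun_apply g q\<bar> < \<delta>"
    using q[unfolded weak_cluster_point_def, rule_format, OF _ \<delta>(1)] by (meson finite_imageI finite_insert finite_lessThan)
  then show ?thesis
  proof (rule frequently_elim1)
    fix y assume y: "\<forall>g\<in>insert f (coordinate_functional ` {..<N}). \<bar>blinfun_apply g y - blinfun_apply g q\<bar> < \<delta>"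
    then have c: "\<bar>coordinate e k (y - q)\<bar> \<le> \<delta>" if "k < N" for k
      using that by (simp add: linear_diff[OF linear_coordinate[OF basis]] less_imp_le)
    have "norm (P {..<N} (y - q)) \<le> (\<Sum>k<N. \<bar>coordinate e k (y - q)\<bar> * norm (e k))"
      unfolding coordinate_projection_def by (rule order_trans[OF norm_sum]) simp
    also have "\<dots> \<le> (\<Sum>k<N. \<delta> * norm (e k))" using c by (intro sum_mono mult_right_mono) auto
    also have "\<dots> = \<delta> * s" by (simp add: s_def sum_distrib_left)
    finally show "\<bar>f y - f q\<bar> < \<eta> \<and> norm (P {..<N} (y - q)) \<le> \<eta>" using y \<delta> by fastforce
  qed
qed

end

text \<open>
  The signs that are \<open>-1\<close> exactly on \<open>A\<close> turn the expansion of \<open>x\<close> into that of \<open>x - 2 P\<^bsub>A\<^esub> x\<close>.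
\<close>

lemma sign_bounded_basis_of_constant:
  fixes e :: "nat \<Rightarrow> 'a::real_normed_vector"
  assumes e: "schauder_basis e" and c: "unconditional_constant e \<le> ereal D" and D: "D \<ge> 0"
  shows "sign_bounded_basis e D"
proof
  fix A :: "nat set" and x assume A: "finite A"
  let ?y = "\<lambda>x. x - 2 *\<^sub>R coordinate_projection e A x"
  have unit: "norm (?y u) \<le> D" if u: "norm u \<le> 1" for u
  proof -
    define \<epsilon> where "\<epsilon> n = (if n \<in> A then -1 else 1::real)" for n
    have "(\<lambda>n. if n \<in> A then coordinate e n u *\<^sub>R e n else 0) sums coordinate_projection e A u"
      unfolding coordinate_projection_def using A by (rule sums_If_finite_set)
    from sums_diff[OF coordinate_sums[OF e, of u] sums_scaleR_right[OF this, of 2]]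
    have "(\<lambda>n. coordinate e n u *\<^sub>R e n - 2 *\<^sub>R (if n \<in> A then coordinate e n u *\<^sub>R e n else 0)) sums ?y u" .
    also have "(\<lambda>n. coordinate e n u *\<^sub>R e n - 2 *\<^sub>R (if n \<in> A then coordinate e n u *\<^sub>R e n else 0))
        = (\<lambda>n. (\<epsilon> n * coordinate e n u) *\<^sub>R e n)"
      by (auto simp: \<epsilon>_def scaleR_2)
    finally have "?y u = (\<Sum>n. (\<epsilon> n * coordinate e n u) *\<^sub>R e n)" by (rule sums_unique)
    then have "ereal (norm (?y u)) \<in> {ereal (norm (\<Sum>n. (\<epsilon> n * a n) *\<^sub>R e n)) | \<epsilon> a x.
            (\<forall>n. \<epsilon> n \<in> {-1, 1::real}) \<and> (\<lambda>n. a n *\<^sub>R e n) sums x \<and> norm x \<le> 1}"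
      using u coordinate_sums[OF e, of u]
      by (intro CollectI exI[of _ \<epsilon>] exI[of _ "\<lambda>n. coordinate e n u"] exI[of _ u]) (auto simp: \<epsilon>_def)
    then have "ereal (norm (?y u)) \<le> unconditional_constant e"
      unfolding unconditional_constant_def by (rule Sup_upper)
    then have "ereal (norm (?y u)) \<le> ereal D" using c by (rule order_trans)
    then show ?thesis by simp
  qed
  show "norm (?y x) \<le> D * norm x"
  proof (cases "x = 0")
    case True
    have "coordinate e k 0 = 0" for k by (rule linear_0[OF linear_coordinate[OF e]])
    then show ?thesis using True by (simp add: coordinate_projection_def)
  next
    case False
    have "?y (x /\<^sub>R norm x) = ?y x /\<^sub>R norm x"
      by (simp add: coordinate_projection_def linear_scale[OF linear_coordinate[OF e]]
          scaleR_right_diff_distrib scaleR_sum_right mult.left_commute)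
    then have "norm (?y x) / norm x \<le> D" using unit[of "x /\<^sub>R norm x"] False
      by (simp add: divide_inverse mult.commute)
    then show ?thesis using False by (simp add: field_simps)
  qed
qed (use e D in auto)

section \<open>Approximate fixed points close to a weak limit\<close>

lemma norm_add3_le: "norm (a + b + c) \<le> norm a + norm b + norm (c :: 'a::real_normed_vector)"
  using norm_triangle_ineq[of "a + b" c] norm_triangle_ineq[of a b] by linarith

lemma norm_add_diff_le: "norm (a + b - c) \<le> norm a + norm b + norm (c :: 'a::real_normed_vector)"
  using norm_add3_le[of a b "- c"] by simp

locale minimal_set_with_basis =
  minimal_invariant_set C K T + sign_bounded_basis e D
  for C K :: "'a::real_normed_vector set" and T :: "'a \<Rightarrow> 'a" and e :: "nat \<Rightarrow> 'a" and D :: real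
begin

text \<open>
  Approximate fixed points have a weak cluster point \<open>p\<close>. Choosing the \<open>n\<close>-th one close to \<open>p\<close> in the
  first coordinates up to \<open>n\<close> makes all coordinates converge, and coordinates separate points.
\<close>

lemma weakly_convergent_approximate_fixed_points:
  "\<exists>x p. p \<in> K \<and> (\<forall>n. x n \<in> K) \<and> (\<lambda>n. norm (T (x n) - x n)) \<longlonglongrightarrow> 0 \<and>
     (\<forall>f::'a \<Rightarrow>\<^sub>L real. (\<lambda>n. blinfun_apply f (x n)) \<longlonglongrightarrow> f p)"
proof -
  have "\<exists>y\<in>K. norm (T y - y) \<le> \<delta>" if "\<delta> > 0" for \<delta>
  proof -
    obtain s k where "0 < s" "s < 1"
      "\<forall>x\<in>K. norm (T (damped_iterate T s x k) - damped_iterate T s x k) \<le> \<delta>"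
      using damped_iterate_approximate_fixed_point[OF \<open>\<delta> > 0\<close>] by blast
    moreover obtain x where "x \<in> K" using nonempty by blast
    ultimately show ?thesis using damped_iterate_in by blast
  qed
  then have "\<forall>n. \<exists>y. y \<in> K \<and> norm (T y - y) \<le> 1 / real (Suc n)"
    by (metis of_nat_0_less_iff zero_less_Suc zero_less_divide_1_iff)
  from choice[OF this] obtain y
    where y: "\<And>n. y n \<in> K" "\<And>n. norm (T (y n) - y n) \<le> 1 / real (Suc n)" by blast
  obtain p where p: "p \<in> K" "weak_cluster_point (filtermap y sequentially) p"
    using cluster_point[of y] y(1) by blast
  have "\<exists>j. norm (T (y j) - y j) \<le> 1 / real (Suc n) \<and> (\<forall>k\<le>n. \<bar>coordinate e k (y j) - coordinate e k p\<bar> < 1 / real (Suc n))" for n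
  proof -
    have "finite (coordinate_functional ` {..n})" "1 / real (Suc n) > 0" by simp_all
    then have "\<exists>\<^sub>F z in filtermap y sequentially. \<forall>f\<in>coordinate_functional ` {..n}.
        \<bar>blinfun_apply f z - blinfun_apply f p\<bar> < 1 / real (Suc n)"
      using p(2)[unfolded weak_cluster_point_def] by blast
    then have "\<exists>\<^sub>F j in sequentially. \<forall>k\<le>n. \<bar>coordinate e k (y j) - coordinate e k p\<bar> < 1 / real (Suc n)"
      unfolding frequently_def eventually_filtermap by (simp add: Bex_def)
    moreover have "\<forall>\<^sub>F j in sequentially. n \<le> j" by (rule eventually_ge_at_top)
    ultimately have "\<exists>\<^sub>F j in sequentially. (\<forall>k\<le>n. \<bar>coordinate e k (y j) - coordinate e k p\<bar> < 1 / real (Suc n)) \<and> n \<le> j"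
      by (rule frequently_eventually_frequently)
    then obtain j where j: "\<forall>k\<le>n. \<bar>coordinate e k (y j) - coordinate e k p\<bar> < 1 / real (Suc n)" "n \<le> j"
      using frequently_ex by fast
    have "1 / real (Suc j) \<le> 1 / real (Suc n)" using j(2) by (intro divide_left_mono) auto
    then have "norm (T (y j) - y j) \<le> 1 / real (Suc n)" using y(2)[of j] by simp
    with j(1) show ?thesis by blast
  qed
  then have "\<forall>n. \<exists>j. norm (T (y j) - y j) \<le> 1 / real (Suc n) \<and> (\<forall>k\<le>n. \<bar>coordinate e k (y j) - coordinate e k p\<bar> < 1 / real (Suc n))"
    by blast
  from choice[OF this] obtain j where j: "\<And>n. norm (T (y (j n)) - y (j n)) \<le> 1 / real (Suc n)"
    "\<And>n k. k \<le> n \<Longrightarrow> \<bar>coordinate e k (y (j n)) - coordinate e k p\<bar> < 1 / real (Suc n)" by blast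
  define x where "x n = y (j n)" for n
  have lim0: "(\<lambda>n. 1 / real (Suc n)) \<longlonglongrightarrow> 0" by (rule LIMSEQ_Suc[OF lim_1_over_n])
  have T0: "(\<lambda>n. norm (T (x n) - x n)) \<longlonglongrightarrow> 0"
    using j(1) by (intro tendsto_sandwich[OF _ _ tendsto_const lim0] always_eventually) (auto simp: x_def)
  have conv: "(\<lambda>n. coordinate e k (x n)) \<longlonglongrightarrow> coordinate e k p" for k
  proof -
    have "(\<lambda>n. coordinate e k (x n) - coordinate e k p) \<longlonglongrightarrow> 0"
    proof (rule tendsto_0_le[OF lim0, where K = 1])
      show "\<forall>\<^sub>F n in sequentially. norm (coordinate e k (x n) - coordinate e k p) \<le> norm (1 / real (Suc n)) * 1"
        using eventually_ge_at_top[of k]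
      proof eventually_elim
        case (elim n)
        then show ?case using j(2)[OF elim] by (simp add: x_def less_imp_le)
      qed
    qed
    then show ?thesis by (simp add: LIM_zero_iff)
  qed
  have xK: "x n \<in> K" for n by (simp add: x_def y)
  have "(\<lambda>n. blinfun_apply f (x n)) \<longlonglongrightarrow> f p" for f :: "'a \<Rightarrow>\<^sub>L real"
  proof (rule weakly_convergent_if_separated[OF weakly_compact, where h = coordinate_functional])
    show "x n \<in> C" for n using xK subset by blast
    show "(\<lambda>n. coordinate_functional k (x n)) \<longlonglongrightarrow> coordinate_functional k p" for k
      using conv by simp
    show "q = p" if "\<And>k. coordinate_functional k q = coordinate_functional k p" for q
      using that by (intro coordinates_determine) simp
  qed
  with p(1) xK T0 show ?thesis by (intro exI[of _ x] exI[of _ p] conjI allI)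
qed

text \<open>
  For fixed \<open>n\<close> cut at an \<open>N\<close> beyond the essential support of \<open>x n - p\<close>; for large \<open>m\<close> the vector
  \<open>x m - p\<close> lives essentially beyond \<open>N\<close>. Reversing the signs before \<open>N\<close> turns the difference of these
  two vectors into the negative of their sum.
\<close>

lemma midpoint_near_limit:
  assumes x: "\<And>n. x n \<in> K"
    and conv: "\<And>k. (\<lambda>n. coordinate e k (x n)) \<longlonglongrightarrow> coordinate e k p" and \<eta>: "\<eta> > 0"
  shows "\<forall>\<^sub>F m in sequentially. norm ((1 / 2) *\<^sub>R (x n + x m) - p) \<le> D * diameter K / 2 + \<eta>"
proof -
  have h: "\<eta> / 2 > 0" using \<eta> by simp
  obtain N where N: "norm ((x n - p) - P {..<N} (x n - p)) \<le> \<eta> / 2"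
    using projection_blocks_small[OF h, of "x n - p"] by blast
  have "\<forall>\<^sub>F m in sequentially. norm (P {..<N} (x m - p)) < \<eta> / 2"
    using h by (intro order_tendstoD(2)[OF projection_tendsto_of_coordinates[OF conv]]) auto
  then show ?thesis
  proof eventually_elim
    case (elim m)
    let ?a = "x n - p" and ?b = "x m - p"
    have eq: "?a + ?b = 2 *\<^sub>R (?a - P {..<N} ?a) + 2 *\<^sub>R P {..<N} ?b - ((?a - ?b) - 2 *\<^sub>R P {..<N} (?a - ?b))"
      unfolding projection_diff[of "{..<N}" ?a ?b] by (simp add: algebra_simps scaleR_2)
    have "norm ((?a - ?b) - 2 *\<^sub>R P {..<N} (?a - ?b)) \<le> D * norm (?a - ?b)"
      by (rule sign_change_le) simp
    also have "\<dots> \<le> D * diameter K"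
      using norm_diff_le_diameter[OF x x, of n m] D_nonneg by (intro mult_left_mono) auto
    finally have 1: "norm ((?a - ?b) - 2 *\<^sub>R P {..<N} (?a - ?b)) \<le> D * diameter K" .
    have "norm (?a + ?b) \<le> norm (2 *\<^sub>R (?a - P {..<N} ?a)) + norm (2 *\<^sub>R P {..<N} ?b)
        + norm ((?a - ?b) - 2 *\<^sub>R P {..<N} (?a - ?b))"
      by (subst eq) (rule norm_add_diff_le)
    also have "\<dots> \<le> \<eta> + \<eta> + D * diameter K"
      using N elim 1 unfolding norm_scaleR by (intro add_mono) auto
    finally have "norm (?a + ?b) \<le> \<eta> + \<eta> + D * diameter K" .
    moreover have "(1 / 2) *\<^sub>R (x n + x m) - p = (1 / 2) *\<^sub>R (?a + ?b)"
      by (simp add: algebra_simps flip: scaleR_2)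
    ultimately show ?case by simp
  qed
qed

text \<open>
  The limits are iterated, first in \<open>m\<close> and then in \<open>n\<close>. This replaces an ultrapower of \<open>K\<close>, and leaves
  \<open>w n m\<close> free to have a weak cluster point in \<open>m\<close> for each \<open>n\<close>. The point \<open>u\<close> is independent of \<open>n\<close> and \<open>m\<close>:
  its tail can be made small before \<open>n\<close> is chosen.
\<close>

definition stays_close :: "(nat \<Rightarrow> 'a) \<Rightarrow> 'a \<Rightarrow> (nat \<Rightarrow> nat \<Rightarrow> 'a) \<Rightarrow> bool" where
  "stays_close x u w \<longleftrightarrow> u \<in> K \<and> (\<forall>n m. w n m \<in> K) \<and>
     (\<forall>\<eta>>0. \<forall>\<^sub>F n in sequentially. \<forall>\<^sub>F m in sequentially.
        norm (w n m - u) \<le> D * diameter K / 2 + \<eta> \<and>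
        norm (w n m - x n) \<le> diameter K / 2 + \<eta> \<and> norm (w n m - x m) \<le> diameter K / 2 + \<eta>)"

lemma stays_close_convex:
  assumes v: "stays_close x u v" and w: "stays_close x u' w" and s: "0 \<le> s" "s \<le> 1"
  shows "stays_close x ((1 - s) *\<^sub>R u + s *\<^sub>R u') (\<lambda>n m. (1 - s) *\<^sub>R v n m + s *\<^sub>R w n m)"
proof -
  have K: "(1 - s) *\<^sub>R a + s *\<^sub>R b \<in> K" if "a \<in> K" "b \<in> K" for a b
    using that s by (intro convexD[OF convex]) auto
  have comb: "norm (((1 - s) *\<^sub>R a + s *\<^sub>R b) - ((1 - s) *\<^sub>R c + s *\<^sub>R d)) \<le> r"
    if "norm (a - c) \<le> r" "norm (b - d) \<le> r" for a b c d :: 'a and r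
  proof -
    have "(1 - s) *\<^sub>R (a - c) + s *\<^sub>R (b - d) \<in> cball 0 r"
      using that s by (intro convexD[OF convex_cball]) auto
    then show ?thesis by (simp add: algebra_simps)
  qed
  have one: "(1 - s) *\<^sub>R a + s *\<^sub>R a = a" for a :: 'a by (simp flip: scaleR_left_distrib)
  have comb1: "norm (((1 - s) *\<^sub>R a + s *\<^sub>R b) - c) \<le> r"
    if "norm (a - c) \<le> r" "norm (b - c) \<le> r" for a b c :: 'a and r
    using comb[OF that] by (simp add: one)
  show ?thesis
    unfolding stays_close_def
  proof (intro conjI allI impI)
    fix \<eta> :: real assume \<eta>: "\<eta> > 0"
    show "\<forall>\<^sub>F n in sequentially. \<forall>\<^sub>F m in sequentially.
        norm (((1 - s) *\<^sub>R v n m + s *\<^sub>R w n m) - ((1 - s) *\<^sub>R u + s *\<^sub>R u')) \<le> D * diameter K / 2 + \<eta> \<and>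
        norm (((1 - s) *\<^sub>R v n m + s *\<^sub>R w n m) - x n) \<le> diameter K / 2 + \<eta> \<and>
        norm (((1 - s) *\<^sub>R v n m + s *\<^sub>R w n m) - x m) \<le> diameter K / 2 + \<eta>"
      using v[unfolded stays_close_def, THEN conjunct2, THEN conjunct2, rule_format, OF \<eta>]
        w[unfolded stays_close_def, THEN conjunct2, THEN conjunct2, rule_format, OF \<eta>]
    proof eventually_elim
      case (elim n)
      then show ?case by eventually_elim (intro conjI comb comb1; blast)
    qed
  qed (use v w K in \<open>auto simp: stays_close_def\<close>)
qed

text \<open>
  The points \<open>x n\<close> are only approximately fixed, but the error vanishes in the limit.
\<close>

lemma stays_close_map:
  assumes x: "\<And>n. x n \<in> K" "(\<lambda>n. norm (T (x n) - x n)) \<longlonglongrightarrow> 0" and w: "stays_close x u w"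
  shows "stays_close x (T u) (\<lambda>n m. T (w n m))"
  unfolding stays_close_def
proof (intro conjI allI impI)
  fix \<eta> :: real assume "\<eta> > 0"
  then have h: "\<eta> / 2 > 0" by simp
  have uK: "u \<in> K" and wK: "w n m \<in> K" for n m using w by (auto simp: stays_close_def)
  have small: "\<forall>\<^sub>F n in sequentially. norm (T (x n) - x n) < \<eta> / 2"
    by (rule order_tendstoD(2)[OF x(2) h])
  have move: "norm (T a - x n) \<le> r + \<eta>"
    if "a \<in> K" "norm (a - x n) \<le> r + \<eta> / 2" "norm (T (x n) - x n) < \<eta> / 2" for a n r
  proof -
    have "norm (T a - x n) \<le> norm (T a - T (x n)) + norm (T (x n) - x n)"
      using norm_triangle_ineq[of "T a - T (x n)" "T (x n) - x n"] by simp
    also have "\<dots> \<le> (r + \<eta> / 2) + \<eta> / 2"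
      using that nonexpansive[OF that(1) x(1), of n] by (intro add_mono) auto
    finally show ?thesis by simp
  qed
  show "\<forall>\<^sub>F n in sequentially. \<forall>\<^sub>F m in sequentially.
      norm (T (w n m) - T u) \<le> D * diameter K / 2 + \<eta> \<and>
      norm (T (w n m) - x n) \<le> diameter K / 2 + \<eta> \<and> norm (T (w n m) - x m) \<le> diameter K / 2 + \<eta>"
    using w[unfolded stays_close_def, THEN conjunct2, THEN conjunct2, rule_format, OF h] small
  proof eventually_elim
    case n: (elim n)
    show ?case using n(1) small
    proof eventually_elim
      case m: (elim m)
      have "norm (T (w n m) - T u) \<le> norm (w n m - u)" by (rule nonexpansive[OF wK uK])
      then have "norm (T (w n m) - T u) \<le> D * diameter K / 2 + \<eta>" using m h by simp
      then show ?case using m n by (intro conjI move wK) auto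
    qed
  qed
qed (use w self_map in \<open>auto simp: stays_close_def\<close>)

lemma stays_close_damped_iterate:
  assumes x: "\<And>n. x n \<in> K" "(\<lambda>n. norm (T (x n) - x n)) \<longlonglongrightarrow> 0" and w: "stays_close x u w"
    and s: "0 < s" "s < 1"
  shows "stays_close x (damped_iterate T s u k) (\<lambda>n m. damped_iterate T s (w n m) k)"
proof (induction k)
  case (Suc k)
  show ?case
    using stays_close_convex[OF stays_close_map[OF x Suc] w, of s] s by simp
qed (use w in simp)

lemma stays_close_midpoints:
  assumes x: "\<And>n. x n \<in> K" and p: "p \<in> K"
    and conv: "\<And>k. (\<lambda>n. coordinate e k (x n)) \<longlonglongrightarrow> coordinate e k p"
  shows "stays_close x p (\<lambda>n m. (1 / 2) *\<^sub>R (x n + x m))"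
  unfolding stays_close_def
proof (intro conjI allI impI p)
  show "(1 / 2) *\<^sub>R (x n + x m) \<in> K" for n m
    using convexD[OF convex x x, of "1 / 2" "1 / 2" n m] by (simp add: scaleR_right_distrib)
  fix \<eta> :: real assume \<eta>: "\<eta> > 0"
  have half: "norm ((1 / 2) *\<^sub>R (a + b) - a) \<le> diameter K / 2 + \<eta>" if "a \<in> K" "b \<in> K" for a b
  proof -
    have "(1 / 2) *\<^sub>R (a + b) - a = (1 / 2) *\<^sub>R (b - a)"
      by (simp add: algebra_simps flip: scaleR_left_distrib)
    then show ?thesis using norm_diff_le_diameter[OF that(2,1)] \<eta> by simp
  qed
  have ev: "\<forall>\<^sub>F m in sequentially. norm ((1 / 2) *\<^sub>R (x n + x m) - p) \<le> D * diameter K / 2 + \<eta> \<and>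
        norm ((1 / 2) *\<^sub>R (x n + x m) - x n) \<le> diameter K / 2 + \<eta> \<and>
        norm ((1 / 2) *\<^sub>R (x n + x m) - x m) \<le> diameter K / 2 + \<eta>" for n
    using midpoint_near_limit[OF x conv \<eta>, of n]
  proof eventually_elim
    case (elim m)
    then show ?case using half[OF x x, of n m] half[OF x x, of m n] by (simp add: add.commute)
  qed
  show "\<forall>\<^sub>F n in sequentially. \<forall>\<^sub>F m in sequentially.
        norm ((1 / 2) *\<^sub>R (x n + x m) - p) \<le> D * diameter K / 2 + \<eta> \<and>
        norm ((1 / 2) *\<^sub>R (x n + x m) - x n) \<le> diameter K / 2 + \<eta> \<and>
        norm ((1 / 2) *\<^sub>R (x n + x m) - x m) \<le> diameter K / 2 + \<eta>"
    by (rule always_eventually) (rule allI, rule ev)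
qed

text \<open>
  The central decomposition of \<open>2 v\<close> for \<open>v = w n m - p\<close>, with \<open>A = {M..<J}\<close> and \<open>B = {..<N} - A\<close>. The
  constants are chosen in the order \<open>M\<close> (tail of \<open>u - p\<close>), \<open>n\<close>, \<open>J\<close> (support of \<open>x n - p\<close>), \<open>q\<close> and
  \<open>N\<close> (support of \<open>q - p\<close>), \<open>m\<close>.
\<close>

lemma close_point_estimate:
  assumes weak: "\<And>f::'a \<Rightarrow>\<^sub>L real. (\<lambda>n. blinfun_apply f (x n)) \<longlonglongrightarrow> f p"
    and w: "stays_close x u w" and \<eta>: "\<eta> > 0"
  shows "\<exists>n m. 2 * norm (w n m - p) \<le> (diameter K / 2 + 5 * \<eta>)
     + ((1 + D) / 2 * (diameter K / 2 + \<eta>) + 2 * \<eta>)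
     + ((1 + D) / 2 * (D * diameter K / 2 + \<eta>) + 2 * \<eta>)"
proof -
  define d where "d = diameter K"
  have conv: "(\<lambda>n. coordinate e k (x n)) \<longlonglongrightarrow> coordinate e k p" for k
    using weak[of "coordinate_functional k"] by simp
  have wK: "w n m \<in> K" for n m using w by (simp add: stays_close_def)
  obtain M where M: "\<And>N. N \<ge> M \<Longrightarrow> norm ((u - p) - P {..<N} (u - p)) \<le> \<eta>"
    "\<And>N. N \<ge> M \<Longrightarrow> norm (P {M..<N} (u - p)) \<le> \<eta>"
    using projection_blocks_small[OF \<eta>, of "u - p"] by blast
  have "\<forall>\<^sub>F n in sequentially. norm (P {..<M} (x n - p)) < \<eta>"
    using \<eta> by (intro order_tendstoD(2)[OF projection_tendsto_of_coordinates[OF conv]]) auto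
  with w[unfolded stays_close_def, THEN conjunct2, THEN conjunct2, rule_format, OF \<eta>]
  have "\<forall>\<^sub>F n in sequentially. norm (P {..<M} (x n - p)) < \<eta> \<and> (\<forall>\<^sub>F m in sequentially.
        norm (w n m - u) \<le> D * d / 2 + \<eta> \<and>
        norm (w n m - x n) \<le> d / 2 + \<eta> \<and> norm (w n m - x m) \<le> d / 2 + \<eta>)"
    unfolding d_def by eventually_elim simp
  then obtain n where n: "norm (P {..<M} (x n - p)) < \<eta>" "\<forall>\<^sub>F m in sequentially.
        norm (w n m - u) \<le> D * d / 2 + \<eta> \<and>
        norm (w n m - x n) \<le> d / 2 + \<eta> \<and> norm (w n m - x m) \<le> d / 2 + \<eta>"
    using eventually_happens'[OF sequentially_bot] by blast
  \<comment> \<open>\<open>n\<close> is fixed from here on\<close>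
  obtain q where q: "q \<in> K" "weak_cluster_point (filtermap (w n) sequentially) q"
    using cluster_point[of "w n"] wK by blast
  obtain N1 where N1: "\<And>N. N \<ge> N1 \<Longrightarrow> norm ((x n - p) - P {..<N} (x n - p)) \<le> \<eta>"
    using projection_blocks_small[OF \<eta>, of "x n - p"] by blast
  obtain N2 where N2: "\<And>N. N \<ge> N2 \<Longrightarrow> norm ((q - p) - P {..<N} (q - p)) \<le> \<eta>"
    using projection_blocks_small[OF \<eta>, of "q - p"] by blast
  define J where "J = max M N1"
  define N where "N = max J N2"
  have MJN: "M \<le> J" "J \<le> N" "M \<le> N" "N1 \<le> J" "N2 \<le> N" by (auto simp: J_def N_def)
  define A where "A = {M..<J}"
  define B where "B = {..<N} - A"
  have fin: "finite A" "finite B" by (simp_all add: A_def B_def)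
  have "{..<N} = A \<union> B" "A \<inter> B = {}" using MJN by (auto simp: A_def B_def)
  then have PN: "P {..<N} y = P A y + P B y" for y
    by (simp add: projection_disjoint_union fin)
  have "{..<J} = {..<M} \<union> A" "{..<M} \<inter> A = {}" using MJN by (auto simp: A_def)
  then have PJ: "P {..<J} y = P {..<M} y + P A y" for y
    by (simp add: projection_disjoint_union fin)
  obtain f :: "'a \<Rightarrow>\<^sub>L real" where f: "\<forall>y. \<bar>f y\<bar> \<le> norm y" "f (q - p) = norm (q - p)"
    using norming_functional[of "q - p"] by blast
  have "\<exists>\<^sub>F m in sequentially. \<bar>f (w n m) - f q\<bar> < \<eta> \<and> norm (P {..<N} (w n m - q)) \<le> \<eta>"
    using weak_cluster_point_projection[OF q(2) \<eta>, of f N]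
    unfolding frequently_def eventually_filtermap by simp
  moreover have "\<forall>\<^sub>F m in sequentially. dist (f (x m)) (f p) < \<eta>"
    using weak[of f] \<eta> by (simp add: tendsto_iff)
  with n(2) have "\<forall>\<^sub>F m in sequentially. norm (w n m - u) \<le> D * d / 2 + \<eta> \<and>
        norm (w n m - x n) \<le> d / 2 + \<eta> \<and> norm (w n m - x m) \<le> d / 2 + \<eta> \<and> \<bar>f (x m) - f p\<bar> < \<eta>"
    by eventually_elim (simp add: dist_real_def)
  ultimately have "\<exists>\<^sub>F m in sequentially. (\<bar>f (w n m) - f q\<bar> < \<eta> \<and> norm (P {..<N} (w n m - q)) \<le> \<eta>) \<and>
      norm (w n m - u) \<le> D * d / 2 + \<eta> \<and>
        norm (w n m - x n) \<le> d / 2 + \<eta> \<and> norm (w n m - x m) \<le> d / 2 + \<eta> \<and> \<bar>f (x m) - f p\<bar> < \<eta>"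
    by (rule frequently_eventually_frequently)
  then obtain m where m: "\<bar>f (w n m) - f q\<bar> < \<eta>" "norm (P {..<N} (w n m - q)) \<le> \<eta>"
      "norm (w n m - u) \<le> D * d / 2 + \<eta>"
      "norm (w n m - x n) \<le> d / 2 + \<eta>" "norm (w n m - x m) \<le> d / 2 + \<eta>" "\<bar>f (x m) - f p\<bar> < \<eta>"
    using frequently_ex by fast
  define v where "v = w n m"
  \<comment> \<open>weak lower semicontinuity of the norm: \<open>f\<close> norms \<open>q - p\<close> and almost agrees there with its value at \<open>v - x m\<close>\<close>
  have "f (v - x m) \<le> d / 2 + \<eta>"
    using f(1)[rule_format, of "v - x m"] m(5) unfolding v_def by linarith
  then have "norm (q - p) \<le> d / 2 + 3 * \<eta>"
    using f(2) m(1,6) unfolding v_def blinfun.diff_right by linarith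
  moreover have "norm (P {..<N} (v - p)) \<le> norm (P {..<N} (v - q)) + norm (q - p) + norm ((q - p) - P {..<N} (q - p))"
  proof -
    have "P {..<N} (v - p) = P {..<N} (v - q) + (q - p) - ((q - p) - P {..<N} (q - p))"
      by (simp add: projection_diff)
    then show ?thesis by (metis norm_add_diff_le)
  qed
  ultimately have 1: "norm (P {..<N} (v - p)) \<le> d / 2 + 5 * \<eta>"
    using m(2) N2[OF MJN(5)] unfolding v_def by linarith
  \<comment> \<open>\<open>x n - p\<close> lies essentially in the block \<open>A\<close>\<close>
  have 2: "norm ((v - p) - P A (v - p)) \<le> (1 + D) / 2 * (d / 2 + \<eta>) + 2 * \<eta>"
  proof -
    have "(v - p) - P A (v - p) = ((v - x n) - P A (v - x n)) + ((x n - p) - P {..<J} (x n - p)) + P {..<M} (x n - p)"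
      by (simp add: projection_diff PJ)
    then have "norm ((v - p) - P A (v - p)) \<le> norm ((v - x n) - P A (v - x n))
        + norm ((x n - p) - P {..<J} (x n - p)) + norm (P {..<M} (x n - p))"
      by (metis norm_add3_le)
    moreover have "norm ((v - x n) - P A (v - x n)) \<le> (1 + D) / 2 * (d / 2 + \<eta>)"
      using D_nonneg m(4) unfolding v_def
      by (intro order_trans[OF norm_complementary_projection_le[OF fin(1)]] mult_left_mono) auto
    ultimately show ?thesis using N1[OF MJN(4)] n(1) by linarith
  qed
  \<comment> \<open>\<open>u - p\<close> lies essentially in \<open>{..<M}\<close>, hence in \<open>B\<close>\<close>
  have 3: "norm ((v - p) - P B (v - p)) \<le> (1 + D) / 2 * (D * d / 2 + \<eta>) + 2 * \<eta>"
  proof -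
    have "(v - p) - P B (v - p) = ((v - u) - P B (v - u)) + ((u - p) - P {..<N} (u - p)) + P A (u - p)"
      by (simp add: projection_diff PN)
    then have "norm ((v - p) - P B (v - p)) \<le> norm ((v - u) - P B (v - u))
        + norm ((u - p) - P {..<N} (u - p)) + norm (P A (u - p))"
      by (metis norm_add3_le)
    moreover have "norm ((v - u) - P B (v - u)) \<le> (1 + D) / 2 * (D * d / 2 + \<eta>)"
      using D_nonneg m(3) unfolding v_def
      by (intro order_trans[OF norm_complementary_projection_le[OF fin(2)]] mult_left_mono) auto
    ultimately show ?thesis using M(1)[OF MJN(3)] M(2)[OF MJN(1)] unfolding A_def by linarith
  qed
  have "2 *\<^sub>R (v - p) = P {..<N} (v - p) + ((v - p) - P A (v - p)) + ((v - p) - P B (v - p))"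
    by (simp add: PN scaleR_2)
  then have "norm (2 *\<^sub>R (v - p)) \<le> norm (P {..<N} (v - p)) + norm ((v - p) - P A (v - p)) + norm ((v - p) - P B (v - p))"
    by (metis norm_add3_le)
  with 1 2 3 have "2 * norm (v - p) \<le> (d / 2 + 5 * \<eta>)
     + ((1 + D) / 2 * (d / 2 + \<eta>) + 2 * \<eta>) + ((1 + D) / 2 * (D * d / 2 + \<eta>) + 2 * \<eta>)"
    unfolding norm_scaleR by simp
  then show ?thesis unfolding v_def d_def by blast
qed

text \<open>
  Start from the midpoints and apply damped iterates entrywise: the result still stays close, and all
  its entries are approximate fixed points, hence nearly at distance \<open>diameter K\<close> from \<open>p\<close>.
\<close>

lemma diameter_eq_zero:
  assumes D: "D\<^sup>2 + 2 * D < 5"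
  shows "diameter K = 0"
proof -
  define d where "d = diameter K"
  obtain x p where p: "p \<in> K" and x: "\<And>n. x n \<in> K" and T: "(\<lambda>n. norm (T (x n) - x n)) \<longlonglongrightarrow> 0"
    and weak: "\<And>f::'a \<Rightarrow>\<^sub>L real. (\<lambda>n. blinfun_apply f (x n)) \<longlonglongrightarrow> f p"
    using weakly_convergent_approximate_fixed_points by blast
  have conv: "(\<lambda>n. coordinate e k (x n)) \<longlonglongrightarrow> coordinate e k p" for k
    using weak[of "coordinate_functional k"] by simp
  have w0: "stays_close x p (\<lambda>n m. (1 / 2) *\<^sub>R (x n + x m))"
    by (rule stays_close_midpoints[OF x p conv])
  \<comment> \<open>the total coefficient of \<open>\<eta>\<close> in the estimates below\<close>
  define c where "c = 12 + D"
  have "2 * d \<le> d / 2 + (1 + D) / 2 * (d / 2) + (1 + D) / 2 * (D * d / 2) + \<kappa>" if \<kappa>: "\<kappa> > 0" for \<kappa>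
  proof -
    define \<eta> where "\<eta> = \<kappa> / c"
    have c: "c > 0" using D_nonneg by (simp add: c_def)
    have \<eta>: "\<eta> > 0" "c * \<eta> = \<kappa>" using \<kappa> c by (simp_all add: \<eta>_def)
    obtain \<delta> where \<delta>: "\<delta> > 0" "\<forall>z\<in>K. norm (T z - z) \<le> \<delta> \<longrightarrow> d - \<eta> \<le> norm (z - p)"
      using goebel_karlovitz[OF p \<eta>(1)] unfolding d_def by blast
    obtain s k where sk: "0 < s" "s < 1"
      "\<forall>x\<in>K. norm (T (damped_iterate T s x k) - damped_iterate T s x k) \<le> \<delta>"
      using damped_iterate_approximate_fixed_point[OF \<delta>(1)] by blast
    define w where "w n m = damped_iterate T s ((1 / 2) *\<^sub>R (x n + x m)) k" for n m
    have w: "stays_close x (damped_iterate T s p k) w"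
      using stays_close_damped_iterate[OF x T w0 sk(1,2), of k] by (simp add: w_def[abs_def])
    obtain n m where nm: "2 * norm (w n m - p) \<le> (d / 2 + 5 * \<eta>)
     + ((1 + D) / 2 * (d / 2 + \<eta>) + 2 * \<eta>) + ((1 + D) / 2 * (D * d / 2 + \<eta>) + 2 * \<eta>)"
      using close_point_estimate[OF weak w \<eta>(1)] unfolding d_def by blast
    have "norm (T (w n m) - w n m) \<le> \<delta>" "w n m \<in> K"
      using sk w0 w by (auto simp: w_def stays_close_def)
    then have "d - \<eta> \<le> norm (w n m - p)" using \<delta>(2) by blast
    with nm have "2 * d \<le> d / 2 + (1 + D) / 2 * (d / 2) + (1 + D) / 2 * (D * d / 2) + c * \<eta>"
      by (simp add: c_def algebra_simps) (simp add: field_simps)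
    then show ?thesis using \<eta>(2) by simp
  qed
  then have "2 * d \<le> d / 2 + (1 + D) / 2 * (d / 2) + (1 + D) / 2 * (D * d / 2)"
    by (rule field_le_epsilon)
  then have "d * (5 - (D\<^sup>2 + 2 * D)) \<le> 0" by (simp add: field_simps power2_eq_square)
  then have "d \<le> 0" using D by (simp add: mult_le_0_iff)
  then show ?thesis using diameter_ge_0[OF bounded] by (simp add: d_def)
qed

end

theorem theorem2:
  fixes e :: "nat \<Rightarrow> 'a::banach"
  assumes "shrinking_basis e"
    and "unconditional_basis e"
    and "unconditional_constant e < ereal (sqrt 6 - 1)"
  shows "weak_fixed_point_property TYPE('a)"
proof -
  have basis: "schauder_basis e" using assms(2) by (simp add: unconditional_basis_def)
  define D where "D = max 0 (real_of_ereal (unconditional_constant e))"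
  have "(0::real) < sqrt 6 - 1" by simp
  have c: "unconditional_constant e \<le> ereal D" and D1: "D < sqrt 6 - 1"
    using assms(3) by (cases "unconditional_constant e"; simp add: D_def)+
  have "D \<ge> 0" by (simp add: D_def)
  then have "(D + 1)\<^sup>2 < (sqrt 6)\<^sup>2" using D1 by (intro power_strict_mono) auto
  then have D2: "D\<^sup>2 + 2 * D < 5" by (simp add: power2_eq_square algebra_simps)
  interpret sign_bounded_basis e D
    by (rule sign_bounded_basis_of_constant[OF basis c]) (simp add: D_def)
  show ?thesis
    unfolding weak_fixed_point_property_def
  proof (intro allI impI, elim conjE)
    fix C :: "'a set" and T
    assume C: "C \<noteq> {}" "compactin weak_topology C" "convex C" "T \<in> C \<rightarrow> C" "nonexpansive_on C T"
    obtain K where "minimal_invariant_set C K T"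
      using minimal_invariant_set_exists[OF C(2,1,3-5)] by blast
    then interpret minimal_invariant_set C K T .
    interpret minimal_set_with_basis C K T e D ..
    obtain x where x: "x \<in> K" using nonempty by blast
    have "norm (T x - x) \<le> 0"
      using norm_diff_le_diameter[OF self_map[OF x] x] diameter_eq_zero[OF D2] by simp
    then show "\<exists>x\<in>C. T x = x" using x subset by auto
  qed
qed

end
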